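(* Let $A$ and $B$ be two irreducible square matrices with entries in $\{0,1\}$ satisfying condition (I). Then every group isomorphism $\alpha:\Gamma_A\to\Gamma_B$ between the continuous full groups is spatial, i.e. there exists a homeomorphism $h:X_A\to X_B$ such that $\alpha(\gamma)=h\circ\gamma\circ h^{-1}$ for all $\gamma\in\Gamma_A$.
   Context: For an $N\times N$ matrix $A$ with entries in $\{0,1\}$ ($N>1$, no zero rows or columns), $X_A=\{(x_n)_{n\in\mathbb{N}}\in\{1,\dots,N\}^{\mathbb{N}} : A(x_n,x_{n+1})=1 \text{ for all } n\in\mathbb{N}\}$ with the product topology (a compact Hausdorff space), and $\sigma_A:X_A\to X_A$ is the shift $\sigma_A((x_n)_n)=(x_{n+1})_n$, a continuous surjection. Condition (I) for $A$ is equivalent to $X_A$ being homeomorphic to a Cantor set (for irreducible $A$: $A$ is not a permutation matrix). The continuous full group $\Gamma_A$ is the group of all homeomorphisms $\tau$ of $X_A$ for which there exist continuous functions $k,l:X_A\to\mathbb{Z}_{+}=\{0,1,2,\dots\}$ with $\sigma_A^{k(x)}(\tau(x))=\sigma_A^{l(x)}(x)$ for all $x\in X_A$. *)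

theory Defs
  imports "HOL-Analysis.Analysis" "HOL-Algebra.Bij" "Jordan_Normal_Form.Matrix"
begin

section \<open>One-sided topological Markov shifts\<close>

text \<open>Matrices are indexed from 0, so the alphabet is \<open>{0, \<dots>, N - 1}\<close> with \<open>N = dim_row A\<close>.\<close>

definition transition_matrix :: "nat mat \<Rightarrow> bool" where
  "transition_matrix A \<longleftrightarrow>
     square_mat A \<and> 1 < dim_row A \<and> elements_mat A \<subseteq> {0, 1} \<and>
     (\<forall>i<dim_row A. \<exists>j<dim_row A. A $$ (i, j) \<noteq> 0) \<and>
     (\<forall>j<dim_row A. \<exists>i<dim_row A. A $$ (i, j) \<noteq> 0)"

definition irreducible_matrix :: "nat mat \<Rightarrow> bool" where
  "irreducible_matrix A \<longleftrightarrow>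
     (\<forall>i<dim_row A. \<forall>j<dim_row A. \<exists>n\<ge>1. 0 < (A ^\<^sub>m n) $$ (i, j))"

text \<open>
  The topology of \<open>nat \<Rightarrow> nat\<close> is the product topology of the discrete topology on \<open>nat\<close>.
  The subspace topology on \<open>markov_shift A\<close> is therefore the one it inherits from the
  product of the finite discrete alphabets.
\<close>

definition markov_shift :: "nat mat \<Rightarrow> (nat \<Rightarrow> nat) set" where
  "markov_shift A =
     {x. \<forall>n. x n < dim_row A \<and> A $$ (x n, x (Suc n)) = 1}"

definition shift :: "(nat \<Rightarrow> nat) \<Rightarrow> nat \<Rightarrow> nat" where
  "shift x = (\<lambda>n. x (Suc n))"

section \<open>Condition (I)\<close>

definition admissible_word :: "nat mat \<Rightarrow> nat list \<Rightarrow> bool" where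
  "admissible_word A w \<longleftrightarrow>
     set w \<subseteq> {..<dim_row A} \<and> successively (\<lambda>i j. A $$ (i, j) = 1) w"

definition first_return_word :: "nat mat \<Rightarrow> nat \<Rightarrow> nat list \<Rightarrow> bool" where
  "first_return_word A j u \<longleftrightarrow> j \<notin> set u \<and> admissible_word A (j # u @ [j])"

text \<open>
  This is the condition of Cuntz and Krieger: every symbol leads to a symbol at which two different
  first-return loops are based.
\<close>

definition condition_I :: "nat mat \<Rightarrow> bool" where
  "condition_I A \<longleftrightarrow>
     (\<forall>i<dim_row A. \<exists>j<dim_row A.
        (\<exists>w. w \<noteq> [] \<and> admissible_word A w \<and> hd w = i \<and> last w = j) \<and>
        (\<exists>u v. u \<noteq> v \<and> first_return_word A j u \<and> first_return_word A j v))"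

section \<open>The continuous full group\<close>

text \<open>
  As in \<^const>\<open>BijGroup\<close>, group elements are extensional functions, so that a homeomorphism of
  \<open>markov_shift A\<close> is represented by exactly one function.
\<close>

definition full_group_set :: "nat mat \<Rightarrow> ((nat \<Rightarrow> nat) \<Rightarrow> nat \<Rightarrow> nat) set" where
  "full_group_set A =
     {\<tau> \<in> extensional (markov_shift A).
        (\<exists>\<tau>'. homeomorphism (markov_shift A) (markov_shift A) \<tau> \<tau>') \<and>
        (\<exists>k l :: (nat \<Rightarrow> nat) \<Rightarrow> nat.
           continuous_on (markov_shift A) k \<and> continuous_on (markov_shift A) l \<and>
           (\<forall>x\<in>markov_shift A. (shift ^^ k x) (\<tau> x) = (shift ^^ l x) x))}"

definition full_group :: "nat mat \<Rightarrow> ((nat \<Rightarrow> nat) \<Rightarrow> nat \<Rightarrow> nat) monoid" where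
  "full_group A = (BijGroup (markov_shift A)) \<lparr>carrier := full_group_set A\<rparr>"

section \<open>The continuous full group is a group\<close>

lemma shift_pow_add: "(shift ^^ m) ((shift ^^ n) x) = (shift ^^ (m + n)) x"
  by (simp add: funpow_add)

lemma full_group_set_Bij: "\<tau> \<in> full_group_set A \<Longrightarrow> \<tau> \<in> Bij (markov_shift A)"
  by (auto simp: full_group_set_def Bij_def homeomorphism_def bij_betw_def intro!: inj_on_inverseI)

lemma compose_full_group_set:
  assumes "\<sigma> \<in> full_group_set A" "\<tau> \<in> full_group_set A"
  shows "compose (markov_shift A) \<sigma> \<tau> \<in> full_group_set A"
proof -
  let ?X = "markov_shift A"
  obtain \<sigma>' k l where s: "homeomorphism ?X ?X \<sigma> \<sigma>'" "continuous_on ?X k" "continuous_on ?X l"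
    "\<forall>x\<in>?X. (shift ^^ k x) (\<sigma> x) = (shift ^^ l x) x"
    using assms(1) unfolding full_group_set_def by blast
  obtain \<tau>' m n where t: "homeomorphism ?X ?X \<tau> \<tau>'" "continuous_on ?X m" "continuous_on ?X n"
    "\<forall>x\<in>?X. (shift ^^ m x) (\<tau> x) = (shift ^^ n x) x"
    using assms(2) unfolding full_group_set_def by blast
  have tX: "\<tau> ` ?X = ?X" and tc: "continuous_on ?X \<tau>"
    using t(1) by (auto simp: homeomorphism_def)
  have "homeomorphism ?X ?X (\<sigma> \<circ> \<tau>) (\<tau>' \<circ> \<sigma>')"
    using homeomorphism_compose[OF t(1) s(1)] .
  then have h: "homeomorphism ?X ?X (compose ?X \<sigma> \<tau>) (\<tau>' \<circ> \<sigma>')"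
    by (rule homeomorphism_cong) (auto simp: compose_def)
  have c: "continuous_on ?X (\<lambda>x. k (\<tau> x) + m x)" "continuous_on ?X (\<lambda>x. l (\<tau> x) + n x)"
    using s t tX tc by (auto intro!: continuous_intros continuous_on_compose2[of ?X _ ?X \<tau>])
  have e: "(shift ^^ (k (\<tau> x) + m x)) (compose ?X \<sigma> \<tau> x) = (shift ^^ (l (\<tau> x) + n x)) x"
    if "x \<in> ?X" for x
  proof -
    have "\<tau> x \<in> ?X" using tX that by blast
    then have "(shift ^^ (m x + k (\<tau> x))) (\<sigma> (\<tau> x)) = (shift ^^ m x) ((shift ^^ l (\<tau> x)) (\<tau> x))"
      using s(4) by (metis shift_pow_add)
    also have "\<dots> = (shift ^^ l (\<tau> x)) ((shift ^^ m x) (\<tau> x))"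
      by (simp add: shift_pow_add add.commute)
    also have "\<dots> = (shift ^^ (l (\<tau> x) + n x)) x"
      using t(4) that by (metis shift_pow_add)
    finally show ?thesis using that by (simp add: compose_def add.commute)
  qed
  show ?thesis
    unfolding full_group_set_def using h c e by (auto simp: compose_def)
qed

lemma inv_full_group_set:
  assumes "\<tau> \<in> full_group_set A"
  shows "restrict (inv_into (markov_shift A) \<tau>) (markov_shift A) \<in> full_group_set A"
proof -
  let ?X = "markov_shift A"
  obtain \<tau>' m n where t: "homeomorphism ?X ?X \<tau> \<tau>'" "continuous_on ?X m" "continuous_on ?X n"
    "\<forall>x\<in>?X. (shift ^^ m x) (\<tau> x) = (shift ^^ n x) x"
    using assms unfolding full_group_set_def by blast
  have eq: "inv_into ?X \<tau> x = \<tau>' x" if "x \<in> ?X" for x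
  proof (rule inv_into_f_eq)
    show "inj_on \<tau> ?X" using t(1) by (auto simp: homeomorphism_def intro!: inj_on_inverseI)
  qed (use t(1) that in \<open>auto simp: homeomorphism_def\<close>)
  have h: "homeomorphism ?X ?X (restrict (inv_into ?X \<tau>) ?X) \<tau>"
    by (rule homeomorphism_cong[OF homeomorphism_symD[OF t(1)]]) (auto simp: eq)
  have tX: "\<tau>' ` ?X = ?X" and tc: "continuous_on ?X \<tau>'"
    using t(1) by (auto simp: homeomorphism_def)
  have c: "continuous_on ?X (\<lambda>x. m (\<tau>' x))" "continuous_on ?X (\<lambda>x. n (\<tau>' x))"
    using t tX tc by (auto intro!: continuous_on_compose2[of ?X _ ?X \<tau>'])
  have e: "(shift ^^ n (\<tau>' x)) (restrict (inv_into ?X \<tau>) ?X x) = (shift ^^ m (\<tau>' x)) x"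
    if "x \<in> ?X" for x
  proof -
    have "\<tau>' x \<in> ?X" "\<tau> (\<tau>' x) = x" using t(1) tX that by (auto simp: homeomorphism_def)
    then show ?thesis using t(4) that eq by (metis restrict_apply')
  qed
  show ?thesis
    unfolding full_group_set_def using h c e by auto
qed

lemma id_full_group_set: "restrict (\<lambda>x. x) (markov_shift A) \<in> full_group_set A"
proof -
  let ?X = "markov_shift A"
  have "homeomorphism ?X ?X (restrict (\<lambda>x. x) ?X) (\<lambda>x. x)"
    by (rule homeomorphism_cong[OF homeomorphism_ident]) auto
  then show ?thesis unfolding full_group_set_def
    by (auto intro!: exI[of _ "\<lambda>_. 0"])
qed

lemma subgroup_full_group_set: "subgroup (full_group_set A) (BijGroup (markov_shift A))"
proof -
  interpret G: group "BijGroup (markov_shift A)" by (rule group_BijGroup)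
  show ?thesis
  proof (rule G.subgroupI)
    show "full_group_set A \<noteq> {}" using id_full_group_set by blast
  next
    fix \<tau> assume "\<tau> \<in> full_group_set A"
    then show "inv\<^bsub>BijGroup (markov_shift A)\<^esub> \<tau> \<in> full_group_set A"
      using inv_full_group_set full_group_set_Bij
      by (simp add: inv_BijGroup)
  next
    fix \<sigma> \<tau> assume "\<sigma> \<in> full_group_set A" "\<tau> \<in> full_group_set A"
    then show "\<sigma> \<otimes>\<^bsub>BijGroup (markov_shift A)\<^esub> \<tau> \<in> full_group_set A"
      using compose_full_group_set full_group_set_Bij
      by (simp add: BijGroup_def)
  qed (auto simp: BijGroup_def full_group_set_Bij)
qed

lemma group_full_group: "group (full_group A)"
  unfolding full_group_def
  by (rule subgroup.subgroup_is_group[OF subgroup_full_group_set group_BijGroup])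

end

theory Submission
  imports Defs
begin

text \<open>
  The supports of the involutions of a continuous full group are clopen and form a base of the
  topology. As in Medynets' reconstruction of Cantor systems from their full groups, the subgroup
  of elements supported in the support of an involution \<open>p\<close> can be described by centralizers only.
  The involutions that commute with \<open>p\<close> and with all their conjugates under the centralizer of \<open>p\<close>
  are supported in the support of \<open>p\<close>, and they include the restrictions of \<open>p\<close> to invariant clopen
  sets; the squares of the elements commuting with all of them therefore act trivially on the
  support of \<open>p\<close>, and their centralizer is the subgroup sought. Hence a group isomorphism preserves
  inclusion of supports of involutions. Matching points that lie in corresponding supports gives,
  by compactness, the homeomorphism.
\<close>

section \<open>Local subgroups of involutions\<close>

text \<open>Involutions are singled out because the fixed-point set of a general element need not be
  open: the element may have an attracting fixed point, for instance a periodic point near which it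
  inserts a period. For an involution the absence of isolated points excludes this, so its support
  is clopen and centralizers recover it exactly, with no passage to the interior of a closure.
  Squares enter because \<open>p\<close> itself commutes with all its pieces, whereas an element
  supported in the support of \<open>p\<close> need not commute with \<open>p\<close>. An element
  commuting with every piece acts on each two-point orbit of \<open>p\<close> as the identity or as
  the exchange, and squaring removes the ambiguity. Detecting points off the support then requires
  elements whose square moves a given point. Equivariance of the point map rests on conjugation:
  conjugating an involution by \<open>g\<close> translates its support by \<open>g\<close>.\<close>

definition commuting :: "('a, 'b) monoid_scheme \<Rightarrow> 'a \<Rightarrow> 'a \<Rightarrow> bool" where
  "commuting G a b \<longleftrightarrow> a \<otimes>\<^bsub>G\<^esub> b = b \<otimes>\<^bsub>G\<^esub> a"

definition involutions :: "('a, 'b) monoid_scheme \<Rightarrow> 'a set" where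
  "involutions G = {g \<in> carrier G. g \<otimes>\<^bsub>G\<^esub> g = \<one>\<^bsub>G\<^esub>}"

text \<open>
  For an involution \<open>p\<close>, \<open>pieces G p\<close> is meant to capture the restrictions of \<open>p\<close> to invariant clopen
  sets, and \<open>local_subgroup G p\<close> the elements supported in the support of \<open>p\<close>.
\<close>

definition pieces :: "('a, 'b) monoid_scheme \<Rightarrow> 'a \<Rightarrow> 'a set" where
  "pieces G p = {g \<in> involutions G. commuting G g p \<and>
     (\<forall>h\<in>carrier G. commuting G h p \<longrightarrow> commuting G g (h \<otimes>\<^bsub>G\<^esub> g \<otimes>\<^bsub>G\<^esub> inv\<^bsub>G\<^esub> h))}"

definition pieces_centralizer :: "('a, 'b) monoid_scheme \<Rightarrow> 'a \<Rightarrow> 'a set" where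
  "pieces_centralizer G p = {f \<in> carrier G. \<forall>u\<in>pieces G p. commuting G f u}"

definition local_subgroup :: "('a, 'b) monoid_scheme \<Rightarrow> 'a \<Rightarrow> 'a set" where
  "local_subgroup G p = {g \<in> carrier G. \<forall>f\<in>pieces_centralizer G p. commuting G g (f \<otimes>\<^bsub>G\<^esub> f)}"

text \<open>\<open>pieces\<close>, \<open>pieces_centralizer\<close> and
  \<open>local_subgroup\<close> are built from the group operation alone, so an isomorphism
  transports them; surjectivity turns their quantifiers over \<open>H\<close> into quantifiers over
  \<open>G\<close>.\<close>

locale group_iso = G: group G + H: group H
  for G :: "('a, 'c) monoid_scheme" and H :: "('b, 'd) monoid_scheme" and \<phi> +
  assumes iso: "\<phi> \<in> iso G H"
begin

lemma closed: "g \<in> carrier G \<Longrightarrow> \<phi> g \<in> carrier H"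
  using iso by (auto simp: iso_iff)

lemma mult: "g \<in> carrier G \<Longrightarrow> h \<in> carrier G \<Longrightarrow> \<phi> (g \<otimes>\<^bsub>G\<^esub> h) = \<phi> g \<otimes>\<^bsub>H\<^esub> \<phi> h"
  using iso by (auto simp: iso_def hom_def)

lemma surj: "carrier H = \<phi> ` carrier G"
  using iso by (auto simp: iso_iff)

lemma eq_iff: "g \<in> carrier G \<Longrightarrow> h \<in> carrier G \<Longrightarrow> \<phi> g = \<phi> h \<longleftrightarrow> g = h"
  using iso by (auto simp: iso_iff inj_on_def)

lemma one: "\<phi> \<one>\<^bsub>G\<^esub> = \<one>\<^bsub>H\<^esub>"
  by (rule hom_one[OF iso_imp_homomorphism[OF iso] G.group_axioms H.group_axioms])

lemma inv: "g \<in> carrier G \<Longrightarrow> \<phi> (inv\<^bsub>G\<^esub> g) = inv\<^bsub>H\<^esub> (\<phi> g)"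
  by (rule H.inv_equality[symmetric]) (simp_all add: closed mult[symmetric] one)

lemma commuting_iff:
  "g \<in> carrier G \<Longrightarrow> h \<in> carrier G \<Longrightarrow> commuting H (\<phi> g) (\<phi> h) \<longleftrightarrow> commuting G g h"
  by (simp add: commuting_def mult[symmetric] eq_iff)

lemma involutions_iff: "g \<in> carrier G \<Longrightarrow> \<phi> g \<in> involutions H \<longleftrightarrow> g \<in> involutions G"
  by (simp add: involutions_def mult[symmetric] one[symmetric] eq_iff closed)

lemma pieces_iff:
  assumes "g \<in> carrier G" "p \<in> carrier G"
  shows "\<phi> g \<in> pieces H (\<phi> p) \<longleftrightarrow> g \<in> pieces G p"
proof -
  have "commuting H (\<phi> g) (\<phi> h \<otimes>\<^bsub>H\<^esub> \<phi> g \<otimes>\<^bsub>H\<^esub> inv\<^bsub>H\<^esub> (\<phi> h)) \<longleftrightarrow> commuting G g (h \<otimes>\<^bsub>G\<^esub> g \<otimes>\<^bsub>G\<^esub> inv\<^bsub>G\<^esub> h)"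
    if "h \<in> carrier G" for h
  proof -
    have "\<phi> h \<otimes>\<^bsub>H\<^esub> \<phi> g \<otimes>\<^bsub>H\<^esub> inv\<^bsub>H\<^esub> (\<phi> h) = \<phi> (h \<otimes>\<^bsub>G\<^esub> g \<otimes>\<^bsub>G\<^esub> inv\<^bsub>G\<^esub> h)"
      using that assms by (simp add: mult inv)
    then show ?thesis using that assms by (simp add: commuting_iff)
  qed
  then show ?thesis
    unfolding pieces_def using assms by (simp add: surj commuting_iff involutions_iff)
qed

lemma pieces_centralizer_iff:
  assumes "g \<in> carrier G" "p \<in> carrier G"
  shows "\<phi> g \<in> pieces_centralizer H (\<phi> p) \<longleftrightarrow> g \<in> pieces_centralizer G p"
proof -
  have "pieces H (\<phi> p) = \<phi> ` pieces G p"
    using pieces_iff assms by (auto simp: pieces_def involutions_def surj)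
  moreover have "pieces G p \<subseteq> carrier G"
    by (auto simp: pieces_def involutions_def)
  ultimately show ?thesis
    unfolding pieces_centralizer_def using assms by (auto simp: closed commuting_iff subset_iff)
qed

lemma local_subgroup_iff:
  assumes "g \<in> carrier G" "p \<in> carrier G"
  shows "\<phi> g \<in> local_subgroup H (\<phi> p) \<longleftrightarrow> g \<in> local_subgroup G p"
proof -
  have "pieces_centralizer H (\<phi> p) = \<phi> ` pieces_centralizer G p"
    using pieces_centralizer_iff assms by (auto simp: pieces_centralizer_def surj)
  moreover have "pieces_centralizer G p \<subseteq> carrier G"
    by (auto simp: pieces_centralizer_def)
  moreover have "commuting H (\<phi> g) (\<phi> f \<otimes>\<^bsub>H\<^esub> \<phi> f) \<longleftrightarrow> commuting G g (f \<otimes>\<^bsub>G\<^esub> f)"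
    if "f \<in> carrier G" for f
    using that assms by (simp add: mult[symmetric] commuting_iff)
  ultimately show ?thesis
    unfolding local_subgroup_def using assms by (auto simp: closed subset_iff)
qed

end

section \<open>Groups with many involutions of small support\<close>

text \<open>Separates the reconstruction from symbolic dynamics, which enters mainly through the
  last three assumptions: they make supports of involutions clopen, supply pieces, and make these
  supports a base.\<close>

locale full_action = group G for G :: "('a::topological_space \<Rightarrow> 'a) monoid" (structure) +
  fixes X :: "'a set"
  assumes compact_space: "compact X"
    and hausdorff_space: "x \<in> X \<Longrightarrow> y \<in> X \<Longrightarrow> x \<noteq> y \<Longrightarrow>
      \<exists>U V. openin (top_of_set X) U \<and> openin (top_of_set X) V \<and> x \<in> U \<and> y \<in> V \<and> U \<inter> V = {}"
    and act_closed [simp]: "g \<in> carrier G \<Longrightarrow> x \<in> X \<Longrightarrow> g x \<in> X"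
    and act_mult [simp]: "g \<in> carrier G \<Longrightarrow> h \<in> carrier G \<Longrightarrow> x \<in> X \<Longrightarrow> (g \<otimes> h) x = g (h x)"
    and act_one [simp]: "x \<in> X \<Longrightarrow> \<one> x = x"
    and act_eqI: "g \<in> carrier G \<Longrightarrow> h \<in> carrier G \<Longrightarrow> (\<And>x. x \<in> X \<Longrightarrow> g x = h x) \<Longrightarrow> g = h"
    and act_continuous: "g \<in> carrier G \<Longrightarrow> continuous_on X g"
    and openin_fixed: "p \<in> involutions G \<Longrightarrow> openin (top_of_set X) {x\<in>X. p x = x}"
    and patch: "p \<in> involutions G \<Longrightarrow> openin (top_of_set X) S \<Longrightarrow> openin (top_of_set X) (X - S) \<Longrightarrow>
      (\<And>x. x \<in> S \<Longrightarrow> p x \<in> S) \<Longrightarrow> \<exists>q\<in>carrier G. \<forall>x\<in>X. q x = (if x \<in> S then p x else x)"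
    and ex_moving: "openin (top_of_set X) S \<Longrightarrow> x \<in> S \<Longrightarrow>
      \<exists>p\<in>involutions G. p x \<noteq> x \<and> (\<forall>y\<in>X - S. p y = y)"
begin

section \<open>Supports and elements of small support\<close>

definition supp :: "('a \<Rightarrow> 'a) \<Rightarrow> 'a set" where
  "supp g = {x \<in> X. g x \<noteq> x}"

lemma supp_subset: "supp g \<subseteq> X"
  by (auto simp: supp_def)

lemma involution_carrier: "p \<in> involutions G \<Longrightarrow> p \<in> carrier G"
  by (simp add: involutions_def)

lemma involution_act: "p \<in> involutions G \<Longrightarrow> x \<in> X \<Longrightarrow> p (p x) = x"
  using act_mult[of p p x] by (simp add: involutions_def)

lemma involutionI: "p \<in> carrier G \<Longrightarrow> (\<And>x. x \<in> X \<Longrightarrow> p (p x) = x) \<Longrightarrow> p \<in> involutions G"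
  unfolding involutions_def by (auto intro!: act_eqI)

lemma inv_act [simp]: "g \<in> carrier G \<Longrightarrow> x \<in> X \<Longrightarrow> (inv g) (g x) = x"
  by (metis act_mult act_one inv_closed l_inv)

lemma act_inv [simp]: "g \<in> carrier G \<Longrightarrow> x \<in> X \<Longrightarrow> g ((inv g) x) = x"
  by (metis act_mult act_one inv_closed r_inv)

lemma inv_act_eq_iff: "g \<in> carrier G \<Longrightarrow> x \<in> X \<Longrightarrow> y \<in> X \<Longrightarrow> (inv g) x = y \<longleftrightarrow> x = g y"
  by (metis inv_act act_inv)

lemma commutingI:
  "g \<in> carrier G \<Longrightarrow> h \<in> carrier G \<Longrightarrow> (\<And>x. x \<in> X \<Longrightarrow> g (h x) = h (g x)) \<Longrightarrow> commuting G g h"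
  unfolding commuting_def by (rule act_eqI) auto

lemma commutingD:
  "commuting G g h \<Longrightarrow> g \<in> carrier G \<Longrightarrow> h \<in> carrier G \<Longrightarrow> x \<in> X \<Longrightarrow> g (h x) = h (g x)"
  unfolding commuting_def by (metis act_mult)

lemma openin_compl_supp:
  assumes "p \<in> involutions G"
  shows "openin (top_of_set X) (X - supp p)"
proof -
  have "X - supp p = {x\<in>X. p x = x}" by (auto simp: supp_def)
  then show ?thesis using openin_fixed[OF assms] by simp
qed

lemma closedin_supp: "p \<in> involutions G \<Longrightarrow> closedin (top_of_set X) (supp p)"
  using openin_compl_supp supp_subset by (simp add: closedin_def)

lemma act_eq_iff: "g \<in> carrier G \<Longrightarrow> x \<in> X \<Longrightarrow> y \<in> X \<Longrightarrow> g x = g y \<longleftrightarrow> x = y"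
  by (metis inv_act)

lemma supp_act: "g \<in> carrier G \<Longrightarrow> x \<in> supp g \<Longrightarrow> g x \<in> supp g"
  by (simp add: supp_def act_eq_iff)

lemma ex_small_involution:
  assumes "openin (top_of_set X) S" "x \<in> S"
  obtains p where "p \<in> involutions G" "x \<in> supp p" "supp p \<subseteq> S"
proof -
  have "x \<in> X" using assms openin_imp_subset by blast
  then show ?thesis using ex_moving[OF assms] that unfolding supp_def by blast
qed

lemma openin_preimage:
  "g \<in> carrier G \<Longrightarrow> openin (top_of_set X) S \<Longrightarrow> openin (top_of_set X) {x\<in>X. g x \<in> S}"
  using continuous_openin_preimage[OF act_continuous, of g X S] 
  by (auto simp: vimage_def Int_def)

lemma separate:
  assumes "x \<in> X" "y \<in> X" "x \<noteq> y"
  obtains S where "openin (top_of_set X) S" "x \<in> S" "y \<notin> S"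
  using hausdorff_space[OF assms] by blast

text \<open>The tool for the computations below: an element supported in \<open>N\<close> fixes
  \<open>g z\<close> for every \<open>z\<close> in \<open>N\<close>, which makes words in the two
  elements easy to evaluate.\<close>

lemma ex_displaced_nbhd:
  assumes "g \<in> carrier G" "openin (top_of_set X) S" "x \<in> S" "g x \<noteq> x"
  obtains N where "openin (top_of_set X) N" "x \<in> N" "N \<subseteq> S" "\<forall>z\<in>N. g z \<notin> N"
proof -
  have x: "x \<in> X" using assms openin_imp_subset by blast
  obtain U V where UV: "openin (top_of_set X) U" "openin (top_of_set X) V"
      "x \<in> U" "g x \<in> V" "U \<inter> V = {}"
    using hausdorff_space[OF x act_closed[OF assms(1) x] assms(4)[symmetric]] by blast
  have "openin (top_of_set X) ({y\<in>X. g y \<in> V} \<inter> U \<inter> S)"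
    by (intro openin_Int openin_preimage assms UV)
  then show ?thesis
    by (rule that) (use UV x assms in auto)
qed

text \<open>Being displaced is an open condition for every element; closedness of the support comes
  from \<open>openin_fixed\<close> and concerns involutions.\<close>

lemma openin_supp:
  assumes "g \<in> carrier G"
  shows "openin (top_of_set X) (supp g)"
proof (subst openin_subopen, intro ballI)
  fix x assume "x \<in> supp g"
  then have x: "x \<in> X" "g x \<noteq> x" by (auto simp: supp_def)
  obtain N where N: "openin (top_of_set X) N" "x \<in> N" "\<forall>z\<in>N. g z \<notin> N"
    using ex_displaced_nbhd[OF assms openin_subtopology_self x] by metis
  have "N \<subseteq> supp g"
  proof
    fix z assume z: "z \<in> N"
    then have "z \<in> X" using openin_imp_subset[OF N(1)] by blast
    moreover have "g z \<noteq> z" using N(3) z by metis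
    ultimately show "z \<in> supp g" by (simp add: supp_def)
  qed
  then show "\<exists>T. openin (top_of_set X) T \<and> x \<in> T \<and> T \<subseteq> supp g" using N by blast
qed

text \<open>
  The product of an involution \<open>a\<close> moving \<open>x\<close> and an involution \<open>b\<close> moving \<open>x\<close> inside a set
  displaced by \<open>a\<close> acts on the orbit of \<open>x\<close> with order larger than two.
\<close>

lemma ex_square_moving:
  assumes "openin (top_of_set X) S" "x \<in> S"
  obtains f where "f \<in> carrier G" "f (f x) \<noteq> x" "supp f \<subseteq> S"
proof -
  have x: "x \<in> X" using assms openin_imp_subset by blast
  obtain a where a: "a \<in> involutions G" "x \<in> supp a" "supp a \<subseteq> S"
    using ex_small_involution[OF assms] .
  then have ac: "a \<in> carrier G" "a x \<noteq> x" by (auto simp: involution_carrier supp_def)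
  obtain N where N: "openin (top_of_set X) N" "x \<in> N" "N \<subseteq> S" "\<forall>z\<in>N. a z \<notin> N"
    using ex_displaced_nbhd[OF ac(1) assms ac(2)] .
  obtain b where b: "b \<in> involutions G" "x \<in> supp b" "supp b \<subseteq> N"
    using ex_small_involution[OF N(1,2)] .
  have bc: "b \<in> carrier G" by (simp add: b involution_carrier)
  have bx: "b x \<in> N" "b x \<noteq> x" "b x \<in> X"
    using supp_act[OF bc b(2)] b x bc by (auto simp: supp_def)
  have "a (b x) \<in> X" "a (b x) \<notin> supp b"
    using bspec[OF N(4) bx(1)] b(3) ac(1) bx(3) by auto
  then have "b (a (b x)) = a (b x)" by (simp add: supp_def)
  then have "(a \<otimes> b) ((a \<otimes> b) x) \<noteq> x"
    using ac bc x bx involution_act[OF a(1) bx(3)] by simp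
  moreover have "supp (a \<otimes> b) \<subseteq> S"
  proof
    fix y assume y: "y \<in> supp (a \<otimes> b)"
    then have "y \<in> supp a \<or> y \<in> supp b" using ac bc by (auto simp: supp_def)
    then show "y \<in> S" using a b N by blast
  qed
  ultimately show ?thesis using that ac bc by blast
qed

lemma commuting_if_disjoint:
  assumes "g \<in> carrier G" "h \<in> carrier G" "supp g \<inter> supp h = {}"
  shows "commuting G g h"
proof (rule commutingI[OF assms(1,2)])
  fix x assume x: "x \<in> X"
  consider "x \<in> supp g" | "x \<in> supp h" | "g x = x" "h x = x"
    using x by (auto simp: supp_def)
  then show "g (h x) = h (g x)"
  proof cases
    case 1
    then have "h x = x" "h (g x) = g x"
      using supp_act[OF assms(1) 1] assms(3) supp_subset by (auto simp: supp_def)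
    then show ?thesis by simp
  next
    case 2
    then have "g x = x" "g (h x) = h x"
      using supp_act[OF assms(2) 2] assms(3) supp_subset by (auto simp: supp_def)
    then show ?thesis by simp
  qed auto
qed

lemma commuting_supp:
  assumes "g \<in> carrier G" "h \<in> carrier G" "commuting G g h" "x \<in> X"
  shows "g x \<in> supp h \<longleftrightarrow> x \<in> supp h"
  using commutingD[OF assms(3,1,2,4), symmetric] assms by (simp add: supp_def act_eq_iff)

section \<open>Pieces of an involution and the support criterion\<close>

text \<open>If \<open>h\<close> commutes with \<open>p\<close>, the conjugate of \<open>q\<close> by
  \<open>h\<close> agrees with \<open>p\<close> on the image of \<open>S\<close> under
  \<open>h\<close> and is the identity elsewhere. That image is again invariant under
  \<open>p\<close>, and two such restrictions of the same \<open>p\<close> commute.\<close>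

lemma piece_if_patch:
  assumes p: "p \<in> involutions G" and q: "q \<in> carrier G"
    and inv: "\<And>x. x \<in> S \<Longrightarrow> p x \<in> S"
    and patch: "\<And>x. x \<in> X \<Longrightarrow> q x = (if x \<in> S then p x else x)"
  shows "q \<in> pieces G p"
proof -
  note pc = involution_carrier[OF p]
  note pp = involution_act[OF p]
  have inv': "p x \<in> S \<longleftrightarrow> x \<in> S" if "x \<in> X" for x using inv pp that by metis
  have "commuting G q p"
    by (rule commutingI[OF q pc]) (simp add: patch pc inv')
  moreover have "q \<in> involutions G"
    by (rule involutionI[OF q]) (auto simp: patch pc inv' pp)
  moreover have "commuting G q (h \<otimes> q \<otimes> inv h)" if h: "h \<in> carrier G" "commuting G h p" for h
  proof (rule commutingI)
    fix x assume x: "x \<in> X"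
    define y where "y = (inv h) x"
    have y: "y \<in> X" "h y = x" using x h by (auto simp: y_def)
    have ph: "p (h z) = h (p z)" if "z \<in> X" for z
      using commutingD[OF h(2,1) pc that] by simp
    have px: "p x = h (p y)" using ph y by metis
    have "(h \<otimes> q \<otimes> inv h) z = (if (inv h) z \<in> S then p z else z)" if z: "z \<in> X" for z
      using h q that ph[of "(inv h) z"] by (simp add: patch)
    moreover have "(inv h) (p x) \<in> S \<longleftrightarrow> (inv h) x \<in> S"
      using y pc h by (simp add: px y_def[symmetric] inv')
    ultimately show "q ((h \<otimes> q \<otimes> inv h) x) = (h \<otimes> q \<otimes> inv h) (q x)"
      using x pc by (auto simp: patch inv')
  qed (use h q in auto)
  ultimately show ?thesis by (simp add: pieces_def)
qed

lemma involution_in_pieces: "p \<in> involutions G \<Longrightarrow> p \<in> pieces G p"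
  by (rule piece_if_patch[of p p X]) (auto simp: involution_carrier)

text \<open>If \<open>g\<close> moved a point \<open>x\<close> off \<open>supp p\<close>, it would
  displace a neighbourhood \<open>N\<close> of \<open>x\<close> there. Every \<open>b\<close>
  supported in \<open>N\<close> commutes with \<open>p\<close>, so \<open>g\<close> must commute
  with its own conjugate by \<open>b\<close>; a \<open>b\<close> with
  \<open>b (b x) \<noteq> x\<close> contradicts this.\<close>

lemma supp_piece_subset:
  assumes p: "p \<in> involutions G" and g: "g \<in> pieces G p"
  shows "supp g \<subseteq> supp p"
proof
  fix x assume "x \<in> supp g"
  then have x: "x \<in> X" "g x \<noteq> x" by (auto simp: supp_def)
  have gi: "g \<in> involutions G" and gc: "g \<in> carrier G"
    using g by (auto simp: pieces_def involutions_def)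
  note gg = involution_act[OF gi]
  note pc = involution_carrier[OF p]
  show "x \<in> supp p"
  proof (rule ccontr)
    assume "x \<notin> supp p"
    then obtain N where N: "openin (top_of_set X) N" "x \<in> N" "N \<subseteq> X - supp p" "\<forall>z\<in>N. g z \<notin> N"
      using ex_displaced_nbhd[OF gc openin_compl_supp[OF p] _ x(2)] x(1) by blast
    obtain b where b: "b \<in> carrier G" "b (b x) \<noteq> x" "supp b \<subseteq> N"
      using ex_square_moving[OF N(1,2)] .
    have "commuting G b p"
      using b N by (intro commuting_if_disjoint pc) auto
    then have comm: "commuting G g (b \<otimes> g \<otimes> inv b)"
      using g b by (simp add: pieces_def)
    have bN: "b z = z" if "z \<in> X" "z \<notin> N" for z using b(3) that by (auto simp: supp_def)
    have ibN: "(inv b) z = z" if "z \<in> X" "z \<notin> N" for z using bN[OF that] b that by (metis inv_act)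
    have "x \<in> supp b" using b(2) x by (auto simp: supp_def)
    then have bx: "b x \<in> N" "b x \<in> X" using supp_act[OF b(1)] b(3) supp_subset by auto
    have gx: "g x \<notin> N" "g x \<in> X" using N x gc by auto
    have gbx: "g (b x) \<notin> N" "g (b x) \<in> X" using N bx gc by auto
    \<comment> \<open>The two sides evaluate to \<open>x\<close> and \<open>b (b x)\<close>, since
      \<open>b\<close> fixes \<open>g x\<close> and \<open>g (b x)\<close>.\<close>
    have "g ((b \<otimes> g \<otimes> inv b) (b x)) = (b \<otimes> g \<otimes> inv b) (g (b x))"
      using comm b gc bx by (intro commutingD) auto
    then have "g (b (g x)) = b (g (g (b x)))"
      using b gc x bx gx gbx ibN by simp
    then show False
      using b(2) gg bN gx x bx by simp
  qed
qed

text \<open>A value \<open>f x\<close> outside \<open>{x, p x}\<close> is separated from that orbit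
  by a \<open>p\<close>-invariant clopen set \<open>T\<close>. The restriction of \<open>p\<close>
  to \<open>T\<close> is a piece, and \<open>f\<close>, commuting with it, would have to preserve
  its support.\<close>

lemma pieces_centralizer_act:
  assumes p: "p \<in> involutions G" and f: "f \<in> pieces_centralizer G p" and x: "x \<in> supp p"
  shows "f (f x) = x"
proof -
  note pc = involution_carrier[OF p]
  note pp = involution_act[OF p]
  have fc: "f \<in> carrier G" using f by (simp add: pieces_centralizer_def)
  have xX: "x \<in> X" using x supp_subset by blast
  have "f x = x \<or> f x = p x"
  proof (rule ccontr)
    assume neg: "\<not> (f x = x \<or> f x = p x)"
    obtain S1 where S1: "openin (top_of_set X) S1" "x \<in> S1" "f x \<notin> S1"
      using separate[OF xX act_closed[OF fc xX]] neg by metis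
    obtain S2 where S2: "openin (top_of_set X) S2" "p x \<in> S2" "f x \<notin> S2"
      using separate[OF act_closed[OF pc xX] act_closed[OF fc xX]] neg by metis
    \<comment> \<open>\<open>n\<close> serves only to provide a clopen neighbourhood of
      \<open>x\<close>. \<open>S1\<close> keeps \<open>f x\<close> out of \<open>supp n\<close>, and
      the condition on \<open>S2\<close> keeps it out of the image of \<open>supp n\<close> under
      \<open>p\<close>.\<close>
    have "openin (top_of_set X) (S1 \<inter> {y\<in>X. p y \<in> S2} \<inter> supp p)"
      by (intro openin_Int S1 S2 openin_preimage openin_supp pc)
    then obtain n where n: "n \<in> involutions G" "x \<in> supp n" "supp n \<subseteq> S1 \<inter> {y\<in>X. p y \<in> S2} \<inter> supp p"
      by (rule ex_small_involution) (use S1 S2 x xX in auto)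
    define T where "T = supp n \<union> {y\<in>X. p y \<in> supp n}"
    have oT: "openin (top_of_set X) T"
      unfolding T_def by (intro openin_Un openin_supp openin_preimage involution_carrier n pc)
    have "openin (top_of_set X) ((X - supp n) \<inter> {y\<in>X. p y \<in> X - supp n})"
      by (intro openin_Int openin_preimage openin_compl_supp n pc)
    also have "(X - supp n) \<inter> {y\<in>X. p y \<in> X - supp n} = X - T"
      using pc by (auto simp: T_def)
    finally have cT: "openin (top_of_set X) (X - T)" .
    have iT: "p y \<in> T" if "y \<in> T" for y
      using that supp_subset[of n] pp pc by (auto simp: T_def)
    obtain q where q: "q \<in> carrier G" "\<And>y. y \<in> X \<Longrightarrow> q y = (if y \<in> T then p y else y)"
      using patch[OF p oT cT iT] by blast
    have "q \<in> pieces G p"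
      using piece_if_patch[OF p q(1) iT q(2)] .
    then have "commuting G f q" using f by (simp add: pieces_centralizer_def)
    then have "f x \<in> supp q \<longleftrightarrow> x \<in> supp q"
      by (intro commuting_supp fc q xX)
    moreover have "x \<in> supp q"
      using x n q(2) by (auto simp: supp_def T_def)
    ultimately have "f x \<in> T" using q(2) by (auto simp: supp_def split: if_splits)
    then show False
      using S1 S2 n pp[of "f x"] by (auto simp: T_def)
  qed
  moreover have "f (p x) = p (f x)"
    using f involution_in_pieces[OF p] xX fc pc
    by (intro commutingD) (auto simp: pieces_centralizer_def)
  ultimately show ?thesis using pp xX by auto
qed

text \<open>If \<open>g\<close> moves \<open>x\<close> off \<open>supp p\<close>, it displaces a
  neighbourhood \<open>N\<close> of \<open>x\<close> there. Some \<open>f\<close> supported in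
  \<open>N\<close> commutes with all pieces, and commuting with its square would give
  \<open>g (f (f x)) = g x\<close> although \<open>f (f x) \<noteq> x\<close>. Conversely, the
  squares fix \<open>supp p\<close> pointwise.\<close>

theorem local_subgroup_eq:
  assumes p: "p \<in> involutions G"
  shows "local_subgroup G p = {g \<in> carrier G. supp g \<subseteq> supp p}"
proof (intro equalityI subsetI)
  fix g assume g: "g \<in> local_subgroup G p"
  then have gc: "g \<in> carrier G" by (simp add: local_subgroup_def)
  have "x \<in> supp p" if "x \<in> supp g" for x
  proof (rule ccontr)
    assume np: "x \<notin> supp p"
    have x: "x \<in> X" "g x \<noteq> x" using that by (auto simp: supp_def)
    then obtain N where N: "openin (top_of_set X) N" "x \<in> N" "N \<subseteq> X - supp p" "\<forall>z\<in>N. g z \<notin> N"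
      using ex_displaced_nbhd[OF gc openin_compl_supp[OF p] _ x(2)] np by blast
    obtain f where f: "f \<in> carrier G" "f (f x) \<noteq> x" "supp f \<subseteq> N"
      using ex_square_moving[OF N(1,2)] .
    have "commuting G f u" if "u \<in> pieces G p" for u
      using f(1,3) N(3) supp_piece_subset[OF p that] that
      by (intro commuting_if_disjoint) (auto simp: pieces_def involutions_def)
    then have "f \<in> pieces_centralizer G p" using f by (simp add: pieces_centralizer_def)
    then have "commuting G g (f \<otimes> f)" using g by (simp add: local_subgroup_def)
    then have "g ((f \<otimes> f) x) = (f \<otimes> f) (g x)"
      by (intro commutingD gc x m_closed f)
    moreover have "g x \<in> X" "g x \<notin> supp f" using bspec[OF N(4,2)] f(3) gc x by auto
    then have "f (g x) = g x" by (simp add: supp_def)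
    ultimately have "g (f (f x)) = g x" using f gc x by simp
    then show False using act_eq_iff[OF gc, of "f (f x)" x] f x by simp
  qed
  then show "g \<in> {g \<in> carrier G. supp g \<subseteq> supp p}" using gc by blast
next
  fix g assume "g \<in> {g \<in> carrier G. supp g \<subseteq> supp p}"
  then have g: "g \<in> carrier G" "supp g \<subseteq> supp p" by auto
  have "commuting G g (f \<otimes> f)" if f: "f \<in> pieces_centralizer G p" for f
  proof (rule commuting_if_disjoint)
    have fc: "f \<in> carrier G" using f by (simp add: pieces_centralizer_def)
    then show "f \<otimes> f \<in> carrier G" by simp
    have "x \<notin> supp (f \<otimes> f)" if "x \<in> supp p" for x
      using pieces_centralizer_act[OF p f that] fc by (auto simp: supp_def)
    then show "supp g \<inter> supp (f \<otimes> f) = {}" using g by blast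
  qed (use g in auto)
  then show "g \<in> local_subgroup G p" using g by (simp add: local_subgroup_def)
qed

end

section \<open>Reconstruction of the space\<close>

locale full_action_iso = X: full_action G X + Y: full_action H Y + group_iso G H \<phi>
  for G :: "('a::topological_space \<Rightarrow> 'a) monoid" and X :: "'a set"
    and H :: "('b::topological_space \<Rightarrow> 'b) monoid" and Y :: "'b set" and \<phi>
begin

text \<open>An equivalence rather than an implication, so that the inverse isomorphism yields the
  converse relation.\<close>

definition corresp :: "'a \<Rightarrow> 'b \<Rightarrow> bool" where
  "corresp x y \<longleftrightarrow> x \<in> X \<and> y \<in> Y \<and> (\<forall>p\<in>involutions G. x \<in> X.supp p \<longleftrightarrow> y \<in> Y.supp (\<phi> p))"

lemma involutions_image: "p \<in> involutions G \<Longrightarrow> \<phi> p \<in> involutions H"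
  using involutions_iff X.involution_carrier by blast

lemma involutions_surj:
  assumes "q \<in> involutions H"
  obtains p where "p \<in> involutions G" "q = \<phi> p"
proof -
  obtain p where "p \<in> carrier G" "q = \<phi> p"
    using Y.involution_carrier[OF assms] surj by auto
  then show ?thesis using assms involutions_iff that by simp
qed

text \<open>Inclusion of supports is membership of \<open>p\<close> in
  \<open>local_subgroup G q\<close>, which the isomorphism preserves.\<close>

lemma supp_mono_iff:
  assumes "p \<in> involutions G" "q \<in> involutions G"
  shows "Y.supp (\<phi> p) \<subseteq> Y.supp (\<phi> q) \<longleftrightarrow> X.supp p \<subseteq> X.supp q"
proof -
  have "p \<in> carrier G" "q \<in> carrier G" using assms X.involution_carrier by auto
  then show ?thesis
    using local_subgroup_iff[of p q] closed[of p] X.local_subgroup_eq[OF assms(2)]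
      Y.local_subgroup_eq[OF involutions_image[OF assms(2)]] by simp
qed

lemma supp_image_empty_iff:
  assumes "p \<in> involutions G"
  shows "Y.supp (\<phi> p) = {} \<longleftrightarrow> X.supp p = {}"
proof -
  have c: "p \<in> carrier G" using assms X.involution_carrier by auto
  have "X.supp p = {} \<longleftrightarrow> p = \<one>\<^bsub>G\<^esub>"
    using X.act_eqI[OF c X.one_closed] by (auto simp: X.supp_def)
  moreover have "Y.supp (\<phi> p) = {} \<longleftrightarrow> \<phi> p = \<one>\<^bsub>H\<^esub>"
    using Y.act_eqI[OF closed[OF c] Y.one_closed] by (auto simp: Y.supp_def)
  ultimately show ?thesis using eq_iff[OF c X.one_closed] one by simp
qed

text \<open>Disjointness is read off from inclusions: around a common point in \<open>Y\<close>
  there is an involution of smaller support, whose preimage under \<open>\<phi>\<close> would be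
  supported in the empty set.\<close>

lemma supp_disjoint:
  assumes "p \<in> involutions G" "q \<in> involutions G" "X.supp p \<inter> X.supp q = {}"
  shows "Y.supp (\<phi> p) \<inter> Y.supp (\<phi> q) = {}"
proof (rule ccontr)
  assume "Y.supp (\<phi> p) \<inter> Y.supp (\<phi> q) \<noteq> {}"
  then obtain y where y: "y \<in> Y.supp (\<phi> p) \<inter> Y.supp (\<phi> q)" by blast
  have "openin (top_of_set Y) (Y.supp (\<phi> p) \<inter> Y.supp (\<phi> q))"
    using assms by (intro openin_Int Y.openin_supp closed X.involution_carrier)
  then obtain d' where d': "d' \<in> involutions H" "y \<in> Y.supp d'" "Y.supp d' \<subseteq> Y.supp (\<phi> p) \<inter> Y.supp (\<phi> q)"
    using Y.ex_small_involution y by metis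
  obtain d where d: "d \<in> involutions G" "d' = \<phi> d" using involutions_surj[OF d'(1)] .
  have "X.supp d \<subseteq> X.supp p \<inter> X.supp q" using d d' assms supp_mono_iff by auto
  then have "Y.supp d' = {}" using assms d supp_image_empty_iff by auto
  then show False using d' by auto
qed

text \<open>Supports of involutions are closed, so by compactness it suffices that finitely many of
  the candidate supports in \<open>Y\<close> meet. An involution moving \<open>x\<close> inside the
  finite intersection in \<open>X\<close> is nontrivial, and so is its image.\<close>

lemma ex_corresp:
  assumes x: "x \<in> X"
  shows "\<exists>y. corresp x y"
proof -
  define P where "P = {p \<in> involutions G. x \<in> X.supp p}"
  have "\<exists>C. Topological_Spaces.closed C \<and> Y.supp (\<phi> p) = Y \<inter> C" if "p \<in> P" for p
  proof -
    have "closedin (top_of_set Y) (Y.supp (\<phi> p))"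
      using that by (auto simp: P_def intro: Y.closedin_supp involutions_image)
    then show ?thesis unfolding closedin_closed .
  qed
  then obtain C where C: "\<And>p. p \<in> P \<Longrightarrow> Topological_Spaces.closed (C p) \<and> Y.supp (\<phi> p) = Y \<inter> C p" by metis
  have "Y \<inter> (\<Inter>p\<in>P. C p) \<noteq> {}"
  proof (rule compact_imp_fip_image[OF Y.compact_space])
    show "Topological_Spaces.closed (C p)" if "p \<in> P" for p using C[OF that] ..
  next
    fix P' assume P': "finite P'" "P' \<subseteq> P"
    \<comment> \<open>Intersecting with \<open>X\<close> covers the empty family.\<close>
    have "openin (top_of_set X) (X \<inter> (\<Inter>p\<in>P'. X.supp p))"
    proof (cases "P' = {}")
      case False
      have "openin (top_of_set X) (\<Inter>p\<in>P'. X.supp p)"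
        using P' False X.openin_supp X.involution_carrier
        by (intro openin_INT2) (auto simp: P_def)
      then show ?thesis by (metis openin_Int openin_subtopology_self)
    qed auto
    then obtain d where d: "d \<in> involutions G" "x \<in> X.supp d" "X.supp d \<subseteq> X \<inter> (\<Inter>p\<in>P'. X.supp p)"
      by (rule X.ex_small_involution) (use P' x in \<open>auto simp: P_def\<close>)
    obtain y where y: "y \<in> Y.supp (\<phi> d)" using supp_image_empty_iff[OF d(1)] d(2) by blast
    have "y \<in> C p" if "p \<in> P'" for p
      using supp_mono_iff[OF d(1), of p] that P' d y C[of p] unfolding P_def by blast
    then show "Y \<inter> (\<Inter>p\<in>P'. C p) \<noteq> {}" using y Y.supp_subset by blast
  qed
  then obtain y where y: "y \<in> Y" "\<And>p. p \<in> P \<Longrightarrow> y \<in> Y.supp (\<phi> p)" using C by blast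
  \<comment> \<open>The other half of the equivalence: since \<open>supp p\<close> is closed, a
    point outside it is moved by an involution supported off it.\<close>
  have "x \<in> X.supp p" if p: "p \<in> involutions G" "y \<in> Y.supp (\<phi> p)" for p
  proof (rule ccontr)
    assume "x \<notin> X.supp p"
    then obtain r where r: "r \<in> involutions G" "x \<in> X.supp r" "X.supp r \<subseteq> X - X.supp p"
      using X.ex_small_involution[OF X.openin_compl_supp[OF p(1)]] x by (metis DiffI)
    then have "Y.supp (\<phi> r) \<inter> Y.supp (\<phi> p) = {}" using p by (intro supp_disjoint) auto
    then show False using y(2)[of r] r p by (auto simp: P_def)
  qed
  then have "corresp x y" using x y unfolding corresp_def P_def by blast
  then show ?thesis ..
qed

lemma corresp_unique:
  assumes "corresp x y" "corresp x y'"
  shows "y = y'"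
proof (rule ccontr)
  assume "y \<noteq> y'"
  moreover have yY: "y \<in> Y" "y' \<in> Y" using assms by (auto simp: corresp_def)
  ultimately obtain S where S: "openin (top_of_set Y) S" "y \<in> S" "y' \<notin> S"
    using Y.separate by metis
  obtain q where q: "q \<in> involutions H" "y \<in> Y.supp q" "Y.supp q \<subseteq> S"
    using Y.ex_small_involution[OF S(1,2)] .
  obtain p where "p \<in> involutions G" "q = \<phi> p" using involutions_surj[OF q(1)] .
  then show False using assms q S unfolding corresp_def by blast
qed

text \<open>\<open>g x\<close> lies in \<open>supp p\<close> exactly when \<open>x\<close> lies in
  the support of the conjugate \<open>q\<close> of \<open>p\<close>, and \<open>\<phi>\<close>
  respects conjugation.\<close>

lemma corresp_act:
  assumes "corresp x y" and g: "g \<in> carrier G"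
  shows "corresp (g x) (\<phi> g y)"
proof -
  have xy: "x \<in> X" "y \<in> Y" using assms by (auto simp: corresp_def)
  have "g x \<in> X.supp p \<longleftrightarrow> \<phi> g y \<in> Y.supp (\<phi> p)" if p: "p \<in> involutions G" for p
  proof -
    note pc = X.involution_carrier[OF p]
    define q where "q = inv\<^bsub>G\<^esub> g \<otimes>\<^bsub>G\<^esub> p \<otimes>\<^bsub>G\<^esub> g"
    have q: "q \<in> involutions G"
      unfolding q_def using g pc X.involution_act[OF p] by (intro X.involutionI) auto
    have \<phi>q: "\<phi> q = inv\<^bsub>H\<^esub> (\<phi> g) \<otimes>\<^bsub>H\<^esub> \<phi> p \<otimes>\<^bsub>H\<^esub> \<phi> g"
      using g pc by (simp add: q_def mult inv)
    have "x \<in> X.supp q \<longleftrightarrow> g x \<in> X.supp p"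
      using g pc xy by (simp add: X.supp_def q_def X.inv_act_eq_iff)
    moreover have "y \<in> Y.supp (\<phi> q) \<longleftrightarrow> \<phi> g y \<in> Y.supp (\<phi> p)"
      using closed[OF g] closed[OF pc] xy by (simp add: Y.supp_def \<phi>q Y.inv_act_eq_iff)
    ultimately show ?thesis using assms(1) q by (auto simp: corresp_def)
  qed
  then show ?thesis using xy g closed[OF g] by (auto simp: corresp_def)
qed

definition point_map :: "'a \<Rightarrow> 'b" where
  "point_map x = (THE y. corresp x y)"

lemma corresp_point_map: "x \<in> X \<Longrightarrow> corresp x (point_map x)"
  unfolding point_map_def using ex_corresp corresp_unique by (metis theI)

lemma corresp_imp_eq: "corresp x y \<Longrightarrow> point_map x = y"
  using corresp_point_map corresp_unique corresp_def by blast

text \<open>The sets \<open>Y.supp (\<phi> p)\<close> form a base, and their preimages are the open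
  sets \<open>X.supp p\<close>.\<close>

lemma continuous_point_map: "continuous_on X point_map"
  unfolding continuous_on_topological
proof (intro ballI allI impI)
  fix x B assume x: "x \<in> X" and B: "open B" "point_map x \<in> B"
  have c: "corresp x (point_map x)" using corresp_point_map[OF x] .
  have "openin (top_of_set Y) (Y \<inter> B)" "point_map x \<in> Y \<inter> B"
    using B c by (auto simp: corresp_def)
  then obtain q where q: "q \<in> involutions H" "point_map x \<in> Y.supp q" "Y.supp q \<subseteq> Y \<inter> B"
    using Y.ex_small_involution by metis
  obtain p where p: "p \<in> involutions G" "q = \<phi> p" using involutions_surj[OF q(1)] .
  obtain A where A: "open A" "X.supp p = X \<inter> A"
    using X.openin_supp[OF X.involution_carrier[OF p(1)]] by (auto simp: openin_open)
  have "x \<in> X.supp p" using c p q by (auto simp: corresp_def)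
  moreover have "point_map z \<in> B" if "z \<in> X" "z \<in> A" for z
    using corresp_point_map[OF that(1)] that p q A unfolding corresp_def by blast
  ultimately show "\<exists>A. open A \<and> x \<in> A \<and> (\<forall>y\<in>X. y \<in> A \<longrightarrow> point_map y \<in> B)"
    using A by blast
qed

theorem spatial:
  "\<exists>h h'. homeomorphism X Y h h' \<and> (\<forall>g\<in>carrier G. \<forall>y\<in>Y. \<phi> g y = h (g (h' y)))"
proof -
  \<comment> \<open>The same construction for the inverse isomorphism supplies the inverse map
    together with its continuity.\<close>
  interpret I: full_action_iso H Y G X "inv_into (carrier G) \<phi>"
    by unfold_locales (rule X.iso_set_sym[OF iso])
  have sym: "I.corresp y x \<longleftrightarrow> corresp x y" for x y
  proof -
    have "inv_into (carrier G) \<phi> (\<phi> p) = p" if "p \<in> involutions G" for p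
      using iso that X.involution_carrier by (auto simp: iso_iff intro: inv_into_f_f)
    then have "(\<forall>q\<in>involutions H. y \<in> Y.supp q \<longleftrightarrow> x \<in> X.supp (inv_into (carrier G) \<phi> q)) \<longleftrightarrow>
        (\<forall>p\<in>involutions G. x \<in> X.supp p \<longleftrightarrow> y \<in> Y.supp (\<phi> p))"
      using involutions_surj involutions_image by metis
    then show ?thesis unfolding corresp_def I.corresp_def by blast
  qed
  have c1: "corresp x (point_map x)" if "x \<in> X" for x using corresp_point_map that .
  have c2: "corresp (I.point_map y) y" if "y \<in> Y" for y using I.corresp_point_map[OF that] sym by simp
  have "homeomorphism X Y point_map I.point_map"
  proof (rule homeomorphismI)
    show "continuous_on X point_map" "continuous_on Y I.point_map"
      by (rule continuous_point_map I.continuous_point_map)+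
    show "point_map ` X \<subseteq> Y" "I.point_map ` Y \<subseteq> X"
      using c1 c2 by (auto simp: corresp_def)
    show "I.point_map (point_map x) = x" if "x \<in> X" for x
      using c1[OF that] sym I.corresp_imp_eq by simp
    show "point_map (I.point_map y) = y" if "y \<in> Y" for y
      using c2[OF that] corresp_imp_eq by simp
  qed
  moreover have "\<phi> g y = point_map (g (I.point_map y))" if "g \<in> carrier G" "y \<in> Y" for g y
    using corresp_imp_eq[OF corresp_act[OF c2 that(1)]] that by simp
  ultimately show ?thesis by blast
qed

end

section \<open>Points of a Markov shift\<close>

text \<open>A basic open set of the product restricts only finitely many coordinates, and these all
  lie below some \<open>n\<close>. This reduces topological arguments on the shift to agreement of
  prefixes.\<close>

lemma openin_sequence_iff:
  fixes X U :: "(nat \<Rightarrow> 'a::discrete_topology) set"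
  shows "openin (top_of_set X) U \<longleftrightarrow>
    U \<subseteq> X \<and> (\<forall>x\<in>U. \<exists>n. \<forall>y\<in>X. (\<forall>i<n. y i = x i) \<longrightarrow> y \<in> U)"
proof (intro iffI conjI ballI)
  assume U: "openin (top_of_set X) U"
  then show "U \<subseteq> X" by (rule openin_imp_subset)
  fix x assume x: "x \<in> U"
  obtain T where T: "open T" "U = X \<inter> T" using U by (auto simp: openin_open)
  have "openin (product_topology (\<lambda>_::nat. euclidean :: 'a topology) UNIV) T"
    using T by (simp add: open_fun_def)
  then obtain B where B: "x \<in> Pi\<^sub>E UNIV B" "finite {i::nat. B i \<noteq> UNIV}" "Pi\<^sub>E UNIV B \<subseteq> T"
    using product_topology_open_contains_basis[of "\<lambda>_. euclidean" UNIV T x] x T(2) by auto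
  obtain n where n: "\<And>i. B i \<noteq> UNIV \<Longrightarrow> i < n"
    using B(2) finite_nat_set_iff_bounded by auto
  have "y \<in> U" if y: "y \<in> X" "\<forall>i<n. y i = x i" for y
  proof -
    have "y i \<in> B i" for i
      using n[of i] y(2) PiE_mem[OF B(1), of i] by (cases "i < n") auto
    then show ?thesis using B(3) T(2) y(1) by auto
  qed
  then show "\<exists>n. \<forall>y\<in>X. (\<forall>i<n. y i = x i) \<longrightarrow> y \<in> U" by blast
next
  assume U: "U \<subseteq> X \<and> (\<forall>x\<in>U. \<exists>n. \<forall>y\<in>X. (\<forall>i<n. y i = x i) \<longrightarrow> y \<in> U)"
  show "openin (top_of_set X) U"
  proof (subst openin_subopen, intro ballI)
    fix x assume x: "x \<in> U"
    then obtain n where n: "\<forall>y\<in>X. (\<forall>i<n. y i = x i) \<longrightarrow> y \<in> U" using U by blast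
    have "open ((\<lambda>y. y i) -` {x i})" for i
      by (rule open_vimage[OF open_discrete continuous_on_product_coordinates])
    then have "open (\<Inter>i<n. (\<lambda>y. y i) -` {x i})" by (intro open_INT) auto
    then have "openin (top_of_set X) (X \<inter> (\<Inter>i<n. (\<lambda>y. y i) -` {x i}))"
      by (rule openin_open_Int)
    then show "\<exists>T. openin (top_of_set X) T \<and> x \<in> T \<and> T \<subseteq> U"
      using n U x by (intro exI[of _ "X \<inter> (\<Inter>i<n. (\<lambda>y. y i) -` {x i})"]) auto
  qed
qed

lemma continuous_on_sequence_discrete_iff:
  fixes X :: "(nat \<Rightarrow> 'a::discrete_topology) set" and f :: "_ \<Rightarrow> 'b::discrete_topology"
  shows "continuous_on X f \<longleftrightarrow> (\<forall>x\<in>X. \<exists>n. \<forall>y\<in>X. (\<forall>i<n. y i = x i) \<longrightarrow> f y = f x)"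
proof
  assume f: "continuous_on X f"
  show "\<forall>x\<in>X. \<exists>n. \<forall>y\<in>X. (\<forall>i<n. y i = x i) \<longrightarrow> f y = f x"
  proof
    fix x assume x: "x \<in> X"
    have "openin (top_of_set X) (X \<inter> f -` {f x})"
      by (intro continuous_openin_preimage_gen f open_discrete)
    then have "\<forall>z\<in>X \<inter> f -` {f x}. \<exists>n. \<forall>y\<in>X. (\<forall>i<n. y i = z i) \<longrightarrow> y \<in> X \<inter> f -` {f x}"
      unfolding openin_sequence_iff ..
    then obtain n where "\<forall>y\<in>X. (\<forall>i<n. y i = x i) \<longrightarrow> y \<in> X \<inter> f -` {f x}"
      using x by blast
    then show "\<exists>n. \<forall>y\<in>X. (\<forall>i<n. y i = x i) \<longrightarrow> f y = f x" by blast
  qed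
next
  assume f: "\<forall>x\<in>X. \<exists>n. \<forall>y\<in>X. (\<forall>i<n. y i = x i) \<longrightarrow> f y = f x"
  show "continuous_on X f"
    unfolding continuous_openin_preimage_eq openin_sequence_iff
  proof (intro allI impI conjI ballI)
    fix T x assume x: "x \<in> X \<inter> f -` T"
    then obtain n where n: "\<forall>y\<in>X. (\<forall>i<n. y i = x i) \<longrightarrow> f y = f x" using f by blast
    have "y \<in> X \<inter> f -` T" if "y \<in> X" "\<forall>i<n. y i = x i" for y
    proof -
      have "f y = f x" using n that by blast
      then show ?thesis using x that(1) by simp
    qed
    then have "\<forall>y\<in>X. (\<forall>i<n. y i = x i) \<longrightarrow> y \<in> X \<inter> f -` T" by blast
    then show "\<exists>n. \<forall>y\<in>X. (\<forall>i<n. y i = x i) \<longrightarrow> y \<in> X \<inter> f -` T" ..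
  qed simp
qed

lemma hausdorff_sequences:
  fixes X :: "(nat \<Rightarrow> 'a::discrete_topology) set"
  assumes "x \<in> X" "y \<in> X" "x \<noteq> y"
  shows "\<exists>U V. openin (top_of_set X) U \<and> openin (top_of_set X) V \<and> x \<in> U \<and> y \<in> V \<and> U \<inter> V = {}"
proof -
  obtain n where n: "x n \<noteq> y n" using assms(3) by blast
  have "openin (top_of_set X) {z\<in>X. z n = c}" for c
    unfolding openin_sequence_iff by (auto intro!: exI[of _ "Suc n"])
  then show ?thesis
    using assms n by (intro exI[of _ "{z\<in>X. z n = x n}"] exI[of _ "{z\<in>X. z n = y n}"]) auto
qed

lemma continuous_on_clopen_if:
  assumes "openin (top_of_set X) S" "openin (top_of_set X) (X - S)"
    and "continuous_on X f" "continuous_on X g"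
  shows "continuous_on X (\<lambda>x. if x \<in> S then f x else g x)"
proof -
  have S: "S \<subseteq> X" using assms(1) by (rule openin_imp_subset)
  then have X: "S \<union> X = X" by auto
  have "closedin (top_of_set X) S" "closedin (top_of_set X) (X - S)"
    using assms(1,2) S by (auto simp: closedin_def double_diff)
  then have "continuous_on (S \<union> (X - S)) (\<lambda>x. if x \<in> S then f x else g x)"
    using assms(3,4) S by (intro continuous_on_cases_local) (auto simp: X intro: continuous_on_subset)
  then show ?thesis by (simp add: X)
qed

section \<open>Powers of the shift and splicing\<close>

lemma shift_funpow: "(shift ^^ n) x i = x (i + n)"
  by (induction n arbitrary: x) (simp_all add: shift_def funpow_swap1)

text \<open>Both sequences are periodic from position \<open>a\<close> on, with period \<open>b - a\<close>.\<close>

lemma shift_funpow_eq_unique: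
  assumes "a < b" "(shift ^^ a) x = (shift ^^ b) x" "(shift ^^ a) y = (shift ^^ b) y"
    and "\<And>i. i < b \<Longrightarrow> y i = x i"
  shows "y = x"
proof
  have step: "z i = z (i - b + a)" if "(shift ^^ a) z = (shift ^^ b) z" "b \<le> i" for z i
    using fun_cong[OF that(1), of "i - b"] that(2) by (simp add: shift_funpow)
  fix i
  show "y i = x i"
  proof (induction i rule: less_induct)
    case (less i)
    show ?case
    proof (cases "i < b")
      case False
      then have "i - b + a < i" using assms(1) by simp
      then show ?thesis using less step[OF assms(2)] step[OF assms(3)] False by simp
    qed (use assms in simp)
  qed
qed

text \<open>The sequences are meant to share the junction letter, \<open>x n = y m\<close>; then
  every transition of the result already occurs in \<open>x\<close> or in \<open>y\<close>.\<close>

definition splice_at :: "(nat \<Rightarrow> 'a) \<Rightarrow> nat \<Rightarrow> (nat \<Rightarrow> 'a) \<Rightarrow> nat \<Rightarrow> nat \<Rightarrow> 'a" where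
  "splice_at x n y m = (\<lambda>i. if i < n then x i else y (i - n + m))"

lemma splice_at_le: "x n = y m \<Longrightarrow> i \<le> n \<Longrightarrow> splice_at x n y m i = x i"
  by (auto simp: splice_at_def)

lemma splice_at_add: "splice_at x n y m (n + i) = y (i + m)"
  by (simp add: splice_at_def)

lemma shift_splice_at: "(shift ^^ n) (splice_at x n y m) = (shift ^^ m) y"
  by (auto simp: shift_funpow splice_at_def)

lemma splice_at_in_markov_shift:
  assumes "x \<in> markov_shift A" "y \<in> markov_shift A" "x n = y m"
  shows "splice_at x n y m \<in> markov_shift A"
  unfolding markov_shift_def
proof (intro CollectI allI)
  fix i
  consider "Suc i < n" | "Suc i = n" | "n \<le> i" by linarith
  then show "splice_at x n y m i < dim_row A \<and>
      A $$ (splice_at x n y m i, splice_at x n y m (Suc i)) = 1"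
    using assms unfolding markov_shift_def splice_at_def
    by cases (auto simp: Suc_diff_le assms(3)[symmetric])
qed

lemma case_nat_in_markov_shift:
  assumes "y \<in> markov_shift A" "i < dim_row A" "A $$ (i, y 0) = 1"
  shows "case_nat i y \<in> markov_shift A"
  using assms by (auto simp: markov_shift_def split: nat.split)

section \<open>Paths, isolated points and compactness\<close>

lemma transition_matrix_entry:
  assumes "transition_matrix A" "i < dim_row A" "j < dim_row A" "A $$ (i, j) \<noteq> 0"
  shows "A $$ (i, j) = 1"
proof -
  have "A $$ (i, j) \<in> elements_mat A"
    using assms by (intro elements_matI[of A "dim_row A" "dim_col A"])
      (auto simp: transition_matrix_def square_mat.simps)
  then show ?thesis using assms by (auto simp: transition_matrix_def)
qed

lemma ex_point_from:
  assumes A: "transition_matrix A" and i: "i < dim_row A"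
  shows "\<exists>x\<in>markov_shift A. x 0 = i"
proof -
  have "\<forall>i<dim_row A. \<exists>j<dim_row A. A $$ (i, j) = 1"
    using A transition_matrix_entry by (metis transition_matrix_def)
  then obtain s where s: "\<And>i. i < dim_row A \<Longrightarrow> s i < dim_row A \<and> A $$ (i, s i) = 1" by metis
  have b: "(s ^^ n) i < dim_row A" for n by (induction n) (use i s in auto)
  have "(\<lambda>n. (s ^^ n) i) \<in> markov_shift A" using b s by (auto simp: markov_shift_def)
  then show ?thesis by (intro bexI) auto
qed

lemma ex_point_extending:
  assumes "transition_matrix A" "admissible_word A w" "w \<noteq> []"
  shows "\<exists>x\<in>markov_shift A. \<forall>i<length w. x i = w ! i"
  using assms(2,3)
proof (induction w rule: induct_list012)
  case (2 a)
  then show ?case using ex_point_from[OF assms(1), of a] by (auto simp: admissible_word_def)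
next
  case (3 a b w)
  then obtain x where x: "x \<in> markov_shift A" "\<forall>i<length (b # w). x i = (b # w) ! i"
    by (auto simp: admissible_word_def)
  have "case_nat a x \<in> markov_shift A"
    using 3 x by (intro case_nat_in_markov_shift) (auto simp: admissible_word_def)
  moreover have "\<forall>i<length (a # b # w). case_nat a x i = (a # b # w) ! i"
    using x(2) by (auto simp: nth_Cons split: nat.split)
  ultimately show ?case by blast
qed simp

text \<open>A positive entry of the matrix product has a nonzero summand, whose index
  \<open>k\<close> is the last intermediate state; the path to \<open>k\<close> is spliced with one
  step to \<open>j\<close>.\<close>

lemma ex_path_of_power:
  assumes A: "transition_matrix A"
  shows "i < dim_row A \<Longrightarrow> j < dim_row A \<Longrightarrow> 0 < (A ^\<^sub>m n) $$ (i, j) \<Longrightarrow>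
    \<exists>x\<in>markov_shift A. x 0 = i \<and> x n = j"
proof (induction n arbitrary: j)
  case 0
  then have "i = j" by (cases "i = j") auto
  then show ?case using ex_point_from[OF A 0(1)] by auto
next
  case (Suc n)
  have c: "A \<in> carrier_mat (dim_row A) (dim_row A)"
    using A by (auto simp: transition_matrix_def square_mat.simps)
  have d: "dim_col A = dim_row A" "dim_row (A ^\<^sub>m n) = dim_row A" "dim_col (A ^\<^sub>m n) = dim_row A"
    using carrier_matD[OF c] carrier_matD[OF pow_carrier_mat[OF c]] by blast+
  have "(A ^\<^sub>m Suc n) $$ (i, j) = row (A ^\<^sub>m n) i \<bullet> col A j"
    using Suc.prems(1,2) d by simp
  also have "\<dots> = (\<Sum>k\<in>{0..<dim_row A}. (A ^\<^sub>m n) $$ (i, k) * A $$ (k, j))"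
    unfolding scalar_prod_def using Suc.prems(1,2) d by (intro sum.cong) auto
  finally have eq: "(A ^\<^sub>m Suc n) $$ (i, j) = (\<Sum>k\<in>{0..<dim_row A}. (A ^\<^sub>m n) $$ (i, k) * A $$ (k, j))" .
  have "(\<Sum>k\<in>{0..<dim_row A}. (A ^\<^sub>m n) $$ (i, k) * A $$ (k, j)) \<noteq> 0"
    using Suc.prems(3) unfolding eq by (rule gr_implies_not0)
  then obtain k where "k \<in> {0..<dim_row A}" "(A ^\<^sub>m n) $$ (i, k) * A $$ (k, j) \<noteq> 0"
    by (rule sum.not_neutral_contains_not_neutral)
  then have k: "k < dim_row A" "(A ^\<^sub>m n) $$ (i, k) * A $$ (k, j) \<noteq> 0" by simp_all
  then have kj: "A $$ (k, j) = 1" using transition_matrix_entry[OF A k(1) Suc.prems(2)] by simp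
  obtain x where x: "x \<in> markov_shift A" "x 0 = i" "x n = k"
    using Suc.IH[OF Suc.prems(1) k(1)] k(2) by auto
  obtain y where y: "y \<in> markov_shift A" "y 0 = j" using ex_point_from[OF A Suc.prems(2)] by auto
  let ?z = "splice_at x n (case_nat k y) 0"
  have "?z \<in> markov_shift A"
    using x y k kj by (intro splice_at_in_markov_shift case_nat_in_markov_shift) auto
  moreover have "?z 0 = i" using x splice_at_le[of x n "case_nat k y" 0 0] by simp
  moreover have "?z (Suc n) = j" using y by (simp add: splice_at_def)
  ultimately show ?case by blast
qed

lemma ex_path:
  assumes "transition_matrix A" "irreducible_matrix A" "i < dim_row A" "j < dim_row A"
  obtains x n where "x \<in> markov_shift A" "x 0 = i" "x n = j"
  using assms ex_path_of_power unfolding irreducible_matrix_def by metis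

text \<open>Extend the loops \<open>j u j\<close> and \<open>j v j\<close> to points. If the points
  agreed, the first return to \<open>j\<close> would occur at the same position, so \<open>u\<close>
  and \<open>v\<close> would have equal length and be equal.\<close>

lemma ex_two_points_from:
  assumes A: "transition_matrix A" "condition_I A"
  shows "\<exists>x\<in>markov_shift A. \<exists>y\<in>markov_shift A. x 0 = y 0 \<and> x \<noteq> y"
proof -
  obtain j u v where uv: "u \<noteq> v" "first_return_word A j u" "first_return_word A j v"
    using A unfolding condition_I_def transition_matrix_def by (metis less_trans zero_less_one)
  obtain x where x: "x \<in> markov_shift A" "\<And>i. i < length u + 2 \<Longrightarrow> x i = (j # u @ [j]) ! i"
    using ex_point_extending[OF A(1), of "j # u @ [j]"] uv by (auto simp: first_return_word_def)
  obtain y where y: "y \<in> markov_shift A" "\<And>i. i < length v + 2 \<Longrightarrow> y i = (j # v @ [j]) ! i"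
    using ex_point_extending[OF A(1), of "j # v @ [j]"] uv by (auto simp: first_return_word_def)
  have u: "j \<notin> set u" and v: "j \<notin> set v" using uv by (auto simp: first_return_word_def)
  have xu: "x (Suc i) = u ! i" if "i < length u" for i using x(2)[of "Suc i"] that by (simp add: nth_append)
  have yv: "y (Suc i) = v ! i" if "i < length v" for i using y(2)[of "Suc i"] that by (simp add: nth_append)
  have xj: "x 0 = j" "x (Suc (length u)) = j" using x(2)[of 0] x(2)[of "Suc (length u)"] by auto
  have yj: "y 0 = j" "y (Suc (length v)) = j" using y(2)[of 0] y(2)[of "Suc (length v)"] by auto
  have "x \<noteq> y"
  proof
    assume eq: "x = y"
    have "\<not> length u < length v" using yv[of "length u"] xj eq v by (metis nth_mem)
    moreover have "\<not> length v < length u" using xu[of "length v"] yj eq u by (metis nth_mem)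
    ultimately have "length u = length v" by simp
    then have "u = v" using xu yv eq by (intro nth_equalityI) auto
    then show False using uv by simp
  qed
  then show ?thesis using x y xj yj by (metis)
qed

text \<open>Irreducibility leads from the letter \<open>x n\<close> to a letter that starts two
  different points \<open>u\<close> and \<open>v\<close>. The prefix continued by either gives two
  distinct points, so one of them differs from \<open>x\<close>.\<close>

lemma no_isolated_point:
  assumes A: "transition_matrix A" "irreducible_matrix A" "condition_I A"
    and x: "x \<in> markov_shift A"
  obtains y where "y \<in> markov_shift A" "\<And>i. i < n \<Longrightarrow> y i = x i" "y \<noteq> x"
proof -
  obtain u v where uv: "u \<in> markov_shift A" "v \<in> markov_shift A" "u 0 = v 0" "u \<noteq> v"
    using ex_two_points_from[OF A(1,3)] by blast
  have "x n < dim_row A" "u 0 < dim_row A" using x uv by (auto simp: markov_shift_def)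
  then obtain z m where z: "z \<in> markov_shift A" "z 0 = x n" "z m = u 0"
    using ex_path[OF A(1,2)] by metis
  define f where "f w = splice_at x n (splice_at z m w 0) 0" for w
  have f: "f w \<in> markov_shift A \<and> (\<forall>i<n. f w i = x i) \<and> (shift ^^ (m + n)) (f w) = w"
    if "w \<in> markov_shift A" "w 0 = u 0" for w
  proof -
    have "splice_at z m w 0 0 = x n" using z that splice_at_le[of z m w 0 0] by simp
    then have "f w \<in> markov_shift A"
      unfolding f_def using x z that by (intro splice_at_in_markov_shift) auto
    moreover have "(shift ^^ (m + n)) (f w) = (shift ^^ m) ((shift ^^ n) (f w))"
      by (simp add: shift_pow_add)
    then have "(shift ^^ (m + n)) (f w) = w"
      by (simp add: f_def shift_splice_at)
    ultimately show ?thesis by (simp add: f_def splice_at_def)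
  qed
  have "f u \<noteq> f v" using f[of u] f[of v] uv by metis
  then show ?thesis using that f[of u] f[of v] uv by metis
qed

lemma compact_markov_shift: "compact (markov_shift A)"
proof -
  have "compactin (product_topology (\<lambda>_::nat. euclidean :: nat topology) UNIV) (Pi\<^sub>E UNIV (\<lambda>_. {..<dim_row A}))"
    by (subst compactin_PiE) (auto intro: finite_imp_compact)
  then have c: "compact (Pi\<^sub>E UNIV (\<lambda>_::nat. {..<dim_row A}))"
    by (simp add: euclidean_product_topology)
  have "openin (top_of_set UNIV) (- markov_shift A)"
    unfolding openin_sequence_iff
  proof (intro conjI ballI)
    fix x assume "x \<in> - markov_shift A"
    then obtain n where n: "\<not> (x n < dim_row A \<and> A $$ (x n, x (Suc n)) = 1)"
      by (auto simp: markov_shift_def)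
    \<comment> \<open>\<open>n + 2\<close> because the condition violated at \<open>n\<close> reads
      the coordinates \<open>n\<close> and \<open>n + 1\<close>.\<close>
    have "y \<notin> markov_shift A" if "\<forall>i<n + 2. y i = x i" for y
    proof -
      have "y n = x n" "y (Suc n) = x (Suc n)" using that by auto
      then have "\<not> (y n < dim_row A \<and> A $$ (y n, y (Suc n)) = 1)" using n by simp
      then show ?thesis unfolding markov_shift_def by blast
    qed
    then have "\<forall>y\<in>UNIV. (\<forall>i<n + 2. y i = x i) \<longrightarrow> y \<in> - markov_shift A" by simp
    then show "\<exists>n. \<forall>y\<in>UNIV. (\<forall>i<n. y i = x i) \<longrightarrow> y \<in> - markov_shift A" by blast
  qed simp
  then have "closed (markov_shift A)" by (simp add: closed_def)
  then have "compact (Pi\<^sub>E UNIV (\<lambda>_::nat. {..<dim_row A}) \<inter> markov_shift A)"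
    using c by (rule compact_Int_closed[rotated])
  also have "Pi\<^sub>E UNIV (\<lambda>_::nat. {..<dim_row A}) \<inter> markov_shift A = markov_shift A"
    by (auto simp: markov_shift_def)
  finally show ?thesis .
qed

section \<open>The continuous full group acts with many small involutions\<close>

lemma carrier_full_group [simp]: "carrier (full_group A) = full_group_set A"
  by (simp add: full_group_def)

lemma full_group_act:
  assumes "g \<in> full_group_set A" "x \<in> markov_shift A"
  shows "g x \<in> markov_shift A"
  using full_group_set_Bij[OF assms(1)] assms(2) by (auto simp: Bij_def bij_betw_def)

lemma full_group_mult:
  assumes "g \<in> full_group_set A" "h \<in> full_group_set A" "x \<in> markov_shift A"
  shows "(g \<otimes>\<^bsub>full_group A\<^esub> h) x = g (h x)"
  using assms full_group_set_Bij by (simp add: full_group_def BijGroup_def compose_def)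

lemma full_group_one: "x \<in> markov_shift A \<Longrightarrow> \<one>\<^bsub>full_group A\<^esub> x = x"
  by (simp add: full_group_def BijGroup_def)

lemma full_group_involution_act:
  assumes "g \<in> involutions (full_group A)" "x \<in> markov_shift A"
  shows "g (g x) = x"
proof -
  have "g \<in> full_group_set A" "g \<otimes>\<^bsub>full_group A\<^esub> g = \<one>\<^bsub>full_group A\<^esub>"
    using assms(1) by (auto simp: involutions_def)
  then show ?thesis using full_group_mult[of g A g x] full_group_one[OF assms(2)] assms(2) by simp
qed

lemma full_group_eqI:
  assumes "g \<in> full_group_set A" "h \<in> full_group_set A"
    and "\<And>x. x \<in> markov_shift A \<Longrightarrow> g x = h x"
  shows "g = h"
  using assms by (intro extensionalityI[of g "markov_shift A" h]) (auto simp: full_group_set_def)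

lemma full_group_continuous: "g \<in> full_group_set A \<Longrightarrow> continuous_on (markov_shift A) g"
  by (auto simp: full_group_set_def homeomorphism_def)

lemma full_group_involutionI:
  assumes "\<tau> \<in> extensional (markov_shift A)" "continuous_on (markov_shift A) \<tau>"
    and act: "\<And>x. x \<in> markov_shift A \<Longrightarrow> \<tau> x \<in> markov_shift A"
      "\<And>x. x \<in> markov_shift A \<Longrightarrow> \<tau> (\<tau> x) = x"
    and "continuous_on (markov_shift A) k" "continuous_on (markov_shift A) l"
      "\<And>x. x \<in> markov_shift A \<Longrightarrow> (shift ^^ k x) (\<tau> x) = (shift ^^ l x) x"
  shows "\<tau> \<in> involutions (full_group A)"
proof -
  have "homeomorphism (markov_shift A) (markov_shift A) \<tau> \<tau>"
    using assms by (intro homeomorphismI) auto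
  then have \<tau>: "\<tau> \<in> full_group_set A"
    using assms unfolding full_group_set_def by blast
  moreover have "\<tau> \<otimes>\<^bsub>full_group A\<^esub> \<tau> = \<one>\<^bsub>full_group A\<^esub>"
  proof (rule full_group_eqI)
    interpret group "full_group A" by (rule group_full_group)
    show "\<tau> \<otimes>\<^bsub>full_group A\<^esub> \<tau> \<in> full_group_set A" "\<one>\<^bsub>full_group A\<^esub> \<in> full_group_set A"
      using m_closed[of \<tau> \<tau>] one_closed \<tau> by simp_all
  qed (simp add: full_group_mult[OF \<tau> \<tau>] full_group_one act)
  ultimately show ?thesis by (simp add: involutions_def)
qed

lemma full_group_patch:
  assumes p: "p \<in> involutions (full_group A)"
    and S: "openin (top_of_set (markov_shift A)) S"
      "openin (top_of_set (markov_shift A)) (markov_shift A - S)"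
    and inv: "\<And>x. x \<in> S \<Longrightarrow> p x \<in> S"
  shows "(\<lambda>x\<in>markov_shift A. if x \<in> S then p x else x) \<in> involutions (full_group A)"
    (is "?q \<in> _")
proof -
  let ?X = "markov_shift A"
  have pc: "p \<in> full_group_set A" using p by (simp add: involutions_def)
  obtain k l where kl: "continuous_on ?X k" "continuous_on ?X l"
      "\<forall>x\<in>?X. (shift ^^ k x) (p x) = (shift ^^ l x) x"
    using pc unfolding full_group_set_def by blast
  \<comment> \<open>Off \<open>S\<close> the patched map is the identity, so both exponents may be 0
    there.\<close>
  let ?k = "\<lambda>x. if x \<in> S then k x else 0" and ?l = "\<lambda>x. if x \<in> S then l x else 0"
  have "continuous_on ?X (\<lambda>x. if x \<in> S then p x else x)"
    by (intro continuous_on_clopen_if S full_group_continuous pc continuous_on_id)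
  then have c: "continuous_on ?X ?q" by (simp cong: continuous_on_cong)
  show ?thesis
  proof (rule full_group_involutionI[where k = ?k and l = ?l])
    show "continuous_on ?X ?k" "continuous_on ?X ?l"
      by (intro continuous_on_clopen_if S kl continuous_on_const)+
    fix x assume x: "x \<in> ?X"
    then show qx: "?q x \<in> ?X" using full_group_act[OF pc] by simp
    show "?q (?q x) = x"
      using x full_group_act[OF pc x] inv full_group_involution_act[OF p x] by simp
    show "(shift ^^ ?k x) (?q x) = (shift ^^ ?l x) x" using x kl(3) by simp
  qed (use c in auto)
qed

text \<open>
  Around a fixed point the involution satisfies \<open>shift\<^sup>K \<circ> \<tau> = shift\<^sup>L\<close> with constant \<open>K\<close>, \<open>L\<close>.
  If \<open>K \<noteq> L\<close>, all points nearby would be eventually periodic with the same preperiod and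
  period, so that the fixed point would be isolated.
\<close>

lemma openin_fixed_full_group:
  assumes A: "transition_matrix A" "irreducible_matrix A" "condition_I A"
    and \<tau>: "\<tau> \<in> involutions (full_group A)"
  shows "openin (top_of_set (markov_shift A)) {x \<in> markov_shift A. \<tau> x = x}"
  unfolding openin_sequence_iff
proof (intro conjI ballI)
  let ?X = "markov_shift A"
  fix x assume "x \<in> {x \<in> ?X. \<tau> x = x}"
  then have x: "x \<in> ?X" "\<tau> x = x" by auto
  have \<tau>c: "\<tau> \<in> full_group_set A" using \<tau> by (simp add: involutions_def)
  obtain k l where kl: "continuous_on ?X k" "continuous_on ?X l"
      "\<forall>x\<in>?X. (shift ^^ k x) (\<tau> x) = (shift ^^ l x) x"
    using \<tau>c unfolding full_group_set_def by blast
  define K where "K = k x"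
  define L where "L = l x"
  obtain n1 where n1: "\<forall>y\<in>?X. (\<forall>i<n1. y i = x i) \<longrightarrow> k y = K"
    using kl(1) x(1) unfolding continuous_on_sequence_discrete_iff K_def by blast
  obtain n2 where n2: "\<forall>y\<in>?X. (\<forall>i<n2. y i = x i) \<longrightarrow> l y = L"
    using kl(2) x(1) unfolding continuous_on_sequence_discrete_iff L_def by blast
  \<comment> \<open>\<open>n1 + n2\<close> makes the exponents constant near \<open>x\<close>. The
    terms \<open>K\<close> and \<open>L\<close>, taken twice, bound the position \<open>b\<close>
    below, which is \<open>2 L - K\<close> or \<open>2 K - L\<close>.\<close>
  define n where "n = n1 + n2 + K + L + K + L"
  have shifts: "(shift ^^ K) (\<tau> y) = (shift ^^ L) y" if "y \<in> ?X" "\<forall>i<n. y i = x i" for y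
  proof -
    have "k y = K" "l y = L" using n1 n2 that by (auto simp: n_def)
    then show ?thesis using kl(3) that(1) by metis
  qed
  \<comment> \<open>By continuity at the fixed point, \<open>\<tau> y\<close> shares
    \<open>n\<close> letters with \<open>x\<close> once \<open>y\<close> shares \<open>n3\<close>
    letters with it.\<close>
  have "openin (top_of_set ?X) {y\<in>?X. \<forall>i<n. y i = x i}"
    unfolding openin_sequence_iff by (auto intro!: exI[of _ n])
  then have "openin (top_of_set ?X) (?X \<inter> \<tau> -` {y\<in>?X. \<forall>i<n. y i = x i})"
    using continuous_openin_preimage[OF full_group_continuous[OF \<tau>c], of ?X] full_group_act[OF \<tau>c] by blast
  moreover have "x \<in> ?X \<inter> \<tau> -` {y\<in>?X. \<forall>i<n. y i = x i}" using x by simp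
  ultimately obtain n3 where n3: "\<forall>y\<in>?X. (\<forall>i<n3. y i = x i) \<longrightarrow> y \<in> ?X \<inter> \<tau> -` {y\<in>?X. \<forall>i<n. y i = x i}"
    unfolding openin_sequence_iff by blast
  have near: "(shift ^^ K) (\<tau> y) = (shift ^^ L) y" "(shift ^^ K) y = (shift ^^ L) (\<tau> y)"
      "\<forall>i<n. y i = x i" "\<forall>i<n. \<tau> y i = x i"
    if y: "y \<in> ?X" "\<forall>i<n + n3. y i = x i" for y
  proof -
    show 1: "\<forall>i<n. y i = x i" using y by simp
    then show "(shift ^^ K) (\<tau> y) = (shift ^^ L) y" using shifts y by blast
    have "\<forall>i<n3. y i = x i" using y(2) by simp
    then have 2: "\<tau> y \<in> ?X" "\<forall>i<n. \<tau> y i = x i" using n3 y(1) by blast+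
    show "\<forall>i<n. \<tau> y i = x i" by (rule 2(2))
    \<comment> \<open>The first relation, taken at \<open>\<tau> y\<close>; the involution property
      makes it a second relation between \<open>y\<close> and \<open>\<tau> y\<close>.\<close>
    show "(shift ^^ K) y = (shift ^^ L) (\<tau> y)"
      using shifts[OF 2] full_group_involution_act[OF \<tau> y(1)] by simp
  qed
  have "K = L"
  proof (rule ccontr)
    assume "K \<noteq> L"
    \<comment> \<open>Eliminating \<open>\<tau> y\<close> from the two relations leaves eventual
      periodicity of \<open>y\<close> with period \<open>2 d\<close>, where \<open>d\<close> is the
      difference of \<open>K\<close> and \<open>L\<close>.\<close>
    obtain a b where ab: "a < b" "b \<le> n" and per: "\<And>y. y \<in> ?X \<Longrightarrow> \<forall>i<n + n3. y i = x i \<Longrightarrow> (shift ^^ a) y = (shift ^^ b) y"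
    proof (cases "K < L")
      case True
      then obtain d where d: "L = K + d" "d > 0" using less_imp_add_positive by blast
      have "(shift ^^ K) y = (shift ^^ (L + d)) y" if y: "y \<in> ?X" "\<forall>i<n + n3. y i = x i" for y
      proof -
        have "(shift ^^ K) y = (shift ^^ d) ((shift ^^ K) (\<tau> y))"
          using near(2)[OF y] by (simp add: shift_pow_add d add.commute)
        also have "\<dots> = (shift ^^ (L + d)) y"
          using near(1)[OF y] by (simp add: shift_pow_add add.commute)
        finally show ?thesis .
      qed
      moreover have "K < L + d" "L + d \<le> n" using d by (auto simp: n_def)
      ultimately show ?thesis using that by blast
    next
      case False
      then have "L < K" using \<open>K \<noteq> L\<close> by simp
      then obtain d where d: "K = L + d" "d > 0" using less_imp_add_positive by blast
      have "(shift ^^ L) y = (shift ^^ (K + d)) y" if y: "y \<in> ?X" "\<forall>i<n + n3. y i = x i" for y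
      proof -
        have "(shift ^^ L) y = (shift ^^ d) ((shift ^^ L) (\<tau> y))"
          using near(1)[OF y] by (simp add: shift_pow_add d add.commute)
        also have "\<dots> = (shift ^^ d) ((shift ^^ K) y)" by (simp only: near(2)[OF y])
        also have "\<dots> = (shift ^^ (K + d)) y" by (simp add: shift_pow_add add.commute)
        finally show ?thesis .
      qed
      moreover have "L < K + d" "K + d \<le> n" using d by (auto simp: n_def)
      ultimately show ?thesis using that by blast
    qed
    obtain y where y: "y \<in> ?X" "\<And>i. i < n + n3 \<Longrightarrow> y i = x i" "y \<noteq> x"
      using no_isolated_point[OF A x(1), of "n + n3"] by metis
    have "y = x"
      by (rule shift_funpow_eq_unique[OF ab(1) per per]) (use x y ab in auto)
    then show False using y(3) by simp
  qed
  \<comment> \<open>With \<open>K = L\<close>, the tails of \<open>y\<close> and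
    \<open>\<tau> y\<close> agree from position \<open>K\<close> on, and below \<open>n\<close> both
    follow \<open>x\<close>.\<close>
  have "\<tau> y = y" if y: "y \<in> ?X" "\<forall>i<n + n3. y i = x i" for y
  proof
    fix i
    show "\<tau> y i = y i"
    proof (cases "i < n")
      case True
      then show ?thesis using near(3,4)[OF y] by simp
    next
      case False
      then have "K \<le> i" by (simp add: n_def)
      then show ?thesis
        using fun_cong[OF near(1)[OF y], of "i - K"] \<open>K = L\<close> by (simp add: shift_funpow)
    qed
  qed
  then show "\<exists>m. \<forall>y\<in>?X. (\<forall>i<m. y i = x i) \<longrightarrow> y \<in> {x \<in> ?X. \<tau> x = x}" by blast
qed auto

text \<open>
  Interchanges the initial words \<open>x\<^sub>0\<dots>x\<^sub>p\<close> and \<open>w\<^sub>0\<dots>w\<^sub>q\<close>, which is meaningful only if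
  \<open>x\<^sub>p = w\<^sub>q\<close> and neither word is a prefix of the other.
\<close>

definition swap_prefixes ::
  "(nat \<Rightarrow> nat) set \<Rightarrow> (nat \<Rightarrow> nat) \<Rightarrow> nat \<Rightarrow> (nat \<Rightarrow> nat) \<Rightarrow> nat \<Rightarrow> (nat \<Rightarrow> nat) \<Rightarrow> nat \<Rightarrow> nat" where
  "swap_prefixes X x p w q = (\<lambda>y\<in>X.
     if \<forall>i\<le>p. y i = x i then splice_at w q y p
     else if \<forall>i\<le>q. y i = w i then splice_at x p y q else y)"

text \<open>Since \<open>p \<le> q\<close>, the letters \<open>w p \<noteq> x p\<close> make the two
  cylinders disjoint, while \<open>x p = w q\<close> makes both splices admissible. Removing the new
  prefix on one side and the old one on the other gives the exponents.\<close>

lemma swap_prefixes_involution: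
  assumes x: "x \<in> markov_shift A" and w: "w \<in> markov_shift A"
    and pq: "p \<le> q" "x p = w q" "w p \<noteq> x p"
  shows "swap_prefixes (markov_shift A) x p w q \<in> involutions (full_group A)" (is "?\<tau> \<in> _")
proof -
  let ?X = "markov_shift A"
  define a where "a y \<longleftrightarrow> (\<forall>i\<le>p. y i = x i)" for y :: "nat \<Rightarrow> nat"
  define b where "b y \<longleftrightarrow> (\<forall>i\<le>q. y i = w i)" for y :: "nat \<Rightarrow> nat"
  have ab: "\<not> a y" if "b y" for y
  proof
    assume "a y"
    then have "y p = x p" by (simp add: a_def)
    moreover have "y p = w p" using that pq(1) by (simp add: b_def)
    ultimately show False using pq(3) by simp
  qed
  have \<tau>: "?\<tau> y = (if a y then splice_at w q y p else if b y then splice_at x p y q else y)"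
    if "y \<in> ?X" for y
    using that unfolding swap_prefixes_def a_def b_def by (simp only: restrict_apply if_True)
  have ea: "w q = y p" if "a y" for y using that pq(2) by (simp add: a_def)
  have eb: "x p = y q" if "b y" for y using that pq(2) by (simp add: b_def)
  have sa: "splice_at w q y p \<in> ?X \<and> b (splice_at w q y p)" if "y \<in> ?X" "a y" for y
    using splice_at_in_markov_shift[of w A y q p] splice_at_le[of w q y p] w that(1) ea[OF that(2)]
    by (simp add: b_def)
  have sb: "splice_at x p y q \<in> ?X \<and> a (splice_at x p y q)" if "y \<in> ?X" "b y" for y
    using splice_at_in_markov_shift[of x A y p q] splice_at_le[of x p y q] x that(1) eb[OF that(2)]
    by (simp add: a_def)
  \<comment> \<open>Stated for arbitrary sequences and lengths because it serves both directions of
    the exchange.\<close>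
  have inv: "splice_at x p (splice_at w q y p) q = y" if "\<forall>i\<le>p. y i = x i" for x w y :: "nat \<Rightarrow> nat" and p q
    using that by (auto simp: splice_at_def fun_eq_iff)
  let ?k = "\<lambda>y. if a y then q else if b y then p else 0"
    and ?l = "\<lambda>y. if a y then p else if b y then q else 0"
  have loc: "a y = a z" "b y = b z" if "\<forall>i<Suc (p + q). y i = z i" for y z
  proof -
    have "y i = z i" if "i \<le> p \<or> i \<le> q" for i using that \<open>\<forall>i<Suc (p + q). y i = z i\<close> by auto
    then show "a y = a z" "b y = b z" unfolding a_def b_def by metis+
  qed
  have kl: "?k y = ?k z \<and> ?l y = ?l z" if "\<forall>i<Suc (p + q). y i = z i" for y z
    using loc[OF that] by simp
  have "continuous_on ?X ?k" "continuous_on ?X ?l"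
    unfolding continuous_on_sequence_discrete_iff
    by (intro ballI exI[of _ "Suc (p + q)"] impI, erule conjunct1[OF kl] conjunct2[OF kl])+
  show ?thesis
  proof (rule full_group_involutionI[where k = ?k and l = ?l])
    show "?\<tau> \<in> extensional ?X" by (simp add: swap_prefixes_def)
    show "continuous_on ?X ?k" "continuous_on ?X ?l" by fact+
    show "continuous_on ?X ?\<tau>"
    proof (rule continuous_on_coordinatewise_then_product, unfold continuous_on_sequence_discrete_iff, intro ballI)
      fix i z assume z: "z \<in> ?X"
      \<comment> \<open>Coordinate \<open>i\<close> of a splice reads its argument at an index of at
        most \<open>p + q + i\<close>.\<close>
      have "?\<tau> y i = ?\<tau> z i" if y: "y \<in> ?X" "\<forall>j<Suc (p + q + i). y j = z j" for y
      proof -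
        have l: "a y = a z" "b y = b z" using loc[of y z] y(2) by auto
        have e: "y j = z j" if "j < Suc (p + q + i)" for j using y(2) that by blast
        show ?thesis using l y(1) z by (simp add: \<tau> splice_at_def e)
      qed
      then show "\<exists>n. \<forall>y\<in>?X. (\<forall>i<n. y i = z i) \<longrightarrow> ?\<tau> y i = ?\<tau> z i" by blast
    qed
    fix y assume y: "y \<in> ?X"
    have "?\<tau> y \<in> ?X \<and> ?\<tau> (?\<tau> y) = y \<and> (shift ^^ ?k y) (?\<tau> y) = (shift ^^ ?l y) y"
    proof -
      consider "a y" | "b y" | "\<not> a y" "\<not> b y" by blast
      then show ?thesis
      proof cases
        case 1
        have "splice_at x p (splice_at w q y p) q = y"
          using inv[of p y x w q] 1 by (simp add: a_def)
        then show ?thesis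
          using sa[OF y 1] ab 1 y by (simp add: \<tau> shift_splice_at)
      next
        case 2
        have "splice_at w q (splice_at x p y q) p = y"
          using inv[of q y w x p] 2 by (simp add: b_def)
        then show ?thesis
          using sb[OF y 2] ab[OF 2] 2 y by (simp add: \<tau> shift_splice_at)
      qed (simp add: \<tau> y)
    qed
    then show "?\<tau> y \<in> ?X" "?\<tau> (?\<tau> y) = y" "(shift ^^ ?k y) (?\<tau> y) = (shift ^^ ?l y) y" by blast+
  qed
qed

text \<open>A second point \<open>z\<close> near \<open>x\<close> first shares the \<open>n\<close>
  letters that force membership in \<open>S\<close>, then differs from \<open>x\<close> at some
  \<open>p\<close>. Irreducibility continues it from \<open>z p\<close> to the letter
  \<open>x p\<close>, giving \<open>w\<close>. Both exchanged prefixes extend the common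
  \<open>n\<close> letters, so nothing outside \<open>S\<close> moves.\<close>

lemma ex_moving_full_group:
  assumes A: "transition_matrix A" "irreducible_matrix A" "condition_I A"
    and S: "openin (top_of_set (markov_shift A)) S" "x \<in> S"
  shows "\<exists>p\<in>involutions (full_group A). p x \<noteq> x \<and> (\<forall>y\<in>markov_shift A - S. p y = y)"
proof -
  let ?X = "markov_shift A"
  have x: "x \<in> ?X" using S openin_imp_subset by blast
  obtain n where n: "\<And>y. y \<in> ?X \<Longrightarrow> (\<And>i. i < n \<Longrightarrow> y i = x i) \<Longrightarrow> y \<in> S"
    using S unfolding openin_sequence_iff by blast
  obtain z where z: "z \<in> ?X" "\<And>i. i < n \<Longrightarrow> z i = x i" "z \<noteq> x"
    using no_isolated_point[OF A x, of n] by metis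
  then obtain p where p: "z p \<noteq> x p" by blast
  then have np: "n \<le> p" using z(2) by (meson not_less)
  have "z p < dim_row A" "x p < dim_row A" using x z by (auto simp: markov_shift_def)
  then obtain y m where y: "y \<in> ?X" "y 0 = z p" "y m = x p"
    using ex_path[OF A(1,2)] by metis
  define w where "w = splice_at z p y 0"
  have w: "w \<in> ?X" unfolding w_def using z y by (intro splice_at_in_markov_shift) auto
  have wz: "w i = z i" if "i \<le> p" for i
    unfolding w_def using splice_at_le[of z p y 0 i] y that by simp
  have wq: "x p = w (p + m)" using y by (simp add: w_def splice_at_add)
  let ?\<tau> = "swap_prefixes ?X x p w (p + m)"
  have "?\<tau> \<in> involutions (full_group A)"
    using x w wq wz[of p] p by (intro swap_prefixes_involution) auto
  moreover have "?\<tau> x \<noteq> x"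
  proof -
    have "?\<tau> x p = w p"
      using x wq splice_at_le[of w "p + m" x p p] by (simp add: swap_prefixes_def)
    then show ?thesis using wz[of p] p by auto
  qed
  moreover have "?\<tau> y = y" if y: "y \<in> ?X - S" for y
  proof -
    obtain i where i: "i < n" "y i \<noteq> x i" using n y by blast
    then have "w i = x i" "i \<le> p" using wz[of i] z(2) np by auto
    then have "\<not> (\<forall>i\<le>p. y i = x i)" "\<not> (\<forall>i\<le>p + m. y i = w i)" using i(2) by (auto intro: exI[of _ i])
    note n = this[THEN if_not_P]
    have "y \<in> ?X" using y by simp
    then show ?thesis by (simp only: swap_prefixes_def restrict_apply if_True n)
  qed
  ultimately show ?thesis by blast
qed

lemma full_action_full_group:
  assumes A: "transition_matrix A" "irreducible_matrix A" "condition_I A"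
  shows "full_action (full_group A) (markov_shift A)"
proof (intro full_action.intro group_full_group, unfold full_action_axioms_def, intro conjI)
  let ?X = "markov_shift A" and ?G = "full_group A"
  show "compact ?X" by (rule compact_markov_shift)
  show "\<forall>x y. x \<in> ?X \<longrightarrow> y \<in> ?X \<longrightarrow> x \<noteq> y \<longrightarrow> (\<exists>U V. openin (top_of_set ?X) U \<and>
      openin (top_of_set ?X) V \<and> x \<in> U \<and> y \<in> V \<and> U \<inter> V = {})"
    by (intro allI impI hausdorff_sequences)
  show "\<forall>g x. g \<in> carrier ?G \<longrightarrow> x \<in> ?X \<longrightarrow> g x \<in> ?X"
    by (simp add: full_group_act)
  show "\<forall>g h x. g \<in> carrier ?G \<longrightarrow> h \<in> carrier ?G \<longrightarrow> x \<in> ?X \<longrightarrow> (g \<otimes>\<^bsub>?G\<^esub> h) x = g (h x)"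
    by (simp add: full_group_mult)
  show "\<forall>x. x \<in> ?X \<longrightarrow> \<one>\<^bsub>?G\<^esub> x = x"
    by (simp add: full_group_one)
  show "\<forall>g h. g \<in> carrier ?G \<longrightarrow> h \<in> carrier ?G \<longrightarrow> (\<forall>x. x \<in> ?X \<longrightarrow> g x = h x) \<longrightarrow> g = h"
  proof (intro allI impI)
    fix g h
    assume "g \<in> carrier ?G" "h \<in> carrier ?G" and eq: "\<forall>x. x \<in> ?X \<longrightarrow> g x = h x"
    then show "g = h" using full_group_eqI[of g A h, OF _ _ eq[rule_format]] by simp
  qed
  show "\<forall>g. g \<in> carrier ?G \<longrightarrow> continuous_on ?X g"
    by (simp add: full_group_continuous)
  show "\<forall>p. p \<in> involutions ?G \<longrightarrow> openin (top_of_set ?X) {x \<in> ?X. p x = x}"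
    using openin_fixed_full_group[OF A] by blast
  show "\<forall>p S. p \<in> involutions ?G \<longrightarrow> openin (top_of_set ?X) S \<longrightarrow> openin (top_of_set ?X) (?X - S) \<longrightarrow>
      (\<forall>x. x \<in> S \<longrightarrow> p x \<in> S) \<longrightarrow> (\<exists>q\<in>carrier ?G. \<forall>x\<in>?X. q x = (if x \<in> S then p x else x))"
  proof (intro allI impI)
    fix p S
    assume p: "p \<in> involutions ?G" and S: "openin (top_of_set ?X) S" "openin (top_of_set ?X) (?X - S)"
      and inv: "\<forall>x. x \<in> S \<longrightarrow> p x \<in> S"
    let ?q = "\<lambda>x\<in>?X. if x \<in> S then p x else x"
    have "?q \<in> involutions ?G" by (rule full_group_patch[OF p S inv[rule_format]])
    then have "?q \<in> carrier ?G" unfolding involutions_def by blast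
    moreover have "\<forall>x\<in>?X. ?q x = (if x \<in> S then p x else x)" by simp
    ultimately show "\<exists>q\<in>carrier ?G. \<forall>x\<in>?X. q x = (if x \<in> S then p x else x)"
      by (intro bexI[of _ ?q])
  qed
  show "\<forall>S x. openin (top_of_set ?X) S \<longrightarrow> x \<in> S \<longrightarrow>
      (\<exists>p\<in>involutions ?G. p x \<noteq> x \<and> (\<forall>y\<in>?X - S. p y = y))"
    using ex_moving_full_group[OF A] by blast
qed

theorem theorem7p2:
  fixes A B :: "nat mat"
    and \<alpha> :: "((nat \<Rightarrow> nat) \<Rightarrow> nat \<Rightarrow> nat) \<Rightarrow> (nat \<Rightarrow> nat) \<Rightarrow> nat \<Rightarrow> nat"
  assumes "transition_matrix A" and "irreducible_matrix A" and "condition_I A"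
    and "transition_matrix B" and "irreducible_matrix B" and "condition_I B"
    and "\<alpha> \<in> iso (full_group A) (full_group B)"
  shows "\<exists>h h'. homeomorphism (markov_shift A) (markov_shift B) h h' \<and>
           (\<forall>\<gamma>\<in>carrier (full_group A). \<alpha> \<gamma> = restrict (h \<circ> \<gamma> \<circ> h') (markov_shift B))"
proof -
  interpret X: full_action "full_group A" "markov_shift A"
    using assms(1-3) by (rule full_action_full_group)
  interpret Y: full_action "full_group B" "markov_shift B"
    using assms(4-6) by (rule full_action_full_group)
  interpret full_action_iso "full_group A" "markov_shift A" "full_group B" "markov_shift B" \<alpha>
    by unfold_locales (rule assms(7))
  obtain h h' where h: "homeomorphism (markov_shift A) (markov_shift B) h h'"
      "\<forall>\<gamma>\<in>carrier (full_group A). \<forall>y\<in>markov_shift B. \<alpha> \<gamma> y = h (\<gamma> (h' y))"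
    using spatial by blast
  have "\<alpha> \<gamma> = restrict (h \<circ> \<gamma> \<circ> h') (markov_shift B)" if "\<gamma> \<in> carrier (full_group A)" for \<gamma>
  proof (rule extensionalityI[where A = "markov_shift B"])
    have "\<alpha> \<gamma> \<in> full_group_set B" using closed[OF that] by simp
    then show "\<alpha> \<gamma> \<in> extensional (markov_shift B)" by (simp add: full_group_set_def)
  qed (use h(2) that in auto)
  then show ?thesis using h(1) by blast
qed

end
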